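(* Let $n = n(k)$ be a sequence of positive integers with $$n(k) \ge \frac{\sqrt{2}\,k}{e}\,2^{k/2}(1+o(1)) \quad\text{as } k\to\infty.$$ Let $X = X_k$ be the number of monochromatic $K_k$'s in a uniformly random red/blue edge-coloring of $K_{n(k)}$. Then, as $k \to \infty$, $X$ is asymptotically normally distributed; that is, $\dfrac{X - E[X]}{\sqrt{\operatorname{Var}(X)}}$ converges in distribution to the standard normal distribution.
   Context: Each edge of the complete graph $K_n$ is colored red or blue, independently and with probability $1/2$ each. A monochromatic $K_k$ is a $k$-subset of the vertices such that all edges of the subgraph it induces have the same color; $X$ counts these subsets. The hypothesis on $n$ means that there is a sequence $\varepsilon_k\to 0$ with $n(k)\ge \frac{\sqrt2\,k}{e}2^{k/2}(1+\varepsilon_k)$ for all sufficiently large $k$. *)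

theory Defs
  imports "HOL-Probability.Probability" "HOL-Library.Ramsey"
begin

text \<open>
  The vertex set of \<open>K\<^sub>n\<close> is \<open>{..<n}\<close> and its edges are the two-element subsets
  \<open>[{..<n}]\<^bsup>2\<^esup>\<close>.  A colouring assigns a Boolean to every edge (\<open>True\<close> is red, \<open>False\<close> is blue);
  sets that are not edges receive the dummy value \<open>False\<close>, which is never inspected.
\<close>

definition random_coloring :: "nat \<Rightarrow> (nat set \<Rightarrow> bool) pmf" where
  "random_coloring n = Pi_pmf ([{..<n}]\<^bsup>2\<^esup>) False (\<lambda>_. bernoulli_pmf (1/2))"

definition mono_cliques :: "nat \<Rightarrow> nat \<Rightarrow> (nat set \<Rightarrow> bool) \<Rightarrow> nat set set" where
  "mono_cliques n k c = {S \<in> [{..<n}]\<^bsup>k\<^esup>. \<exists>col. \<forall>e\<in>[S]\<^bsup>2\<^esup>. c e = col}"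

definition num_mono_cliques :: "nat \<Rightarrow> nat \<Rightarrow> (nat set \<Rightarrow> bool) \<Rightarrow> real" where
  "num_mono_cliques n k c = real (card (mono_cliques n k c))"

text \<open>
  If the variance is zero, the quotient below is \<open>0\<close> by the convention \<open>x / 0 = 0\<close>.  For
  the clique count with \<open>n = n(k)\<close> growing as in the theorem, this concerns finitely many \<open>k\<close>.
\<close>

definition standardized :: "'a pmf \<Rightarrow> ('a \<Rightarrow> real) \<Rightarrow> 'a \<Rightarrow> real" where
  "standardized p X \<omega> =
     (X \<omega> - measure_pmf.expectation p X) / sqrt (measure_pmf.variance p X)"

end

theory Submission
  imports Defs "HOL-Real_Asymp.Real_Asymp"
begin

text \<open>
  Write \<open>X\<close> as the sum of the indicators \<open>I A\<close> of the event that the \<open>k\<close>-set \<open>A\<close> is monochromatic, and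
  let \<open>q = (1/2) ^ (k choose 2)\<close>, so that \<open>I A\<close> has mean \<open>2 * q\<close>.  Conditioning on \<open>I A = 1\<close> is the same as
  recolouring all edges inside \<open>A\<close> with one uniformly random colour.  If \<open>shift A col\<close> denotes the change
  of \<open>X\<close> under this recolouring, then for every function \<open>g\<close>
  \<open>E ((X - E X) * g X) = q * (\<Sum>A. \<Sum>col. E (g (X + shift A col) - g X))\<close>  (\<open>size_bias_count\<close>).
  For \<open>g x = exp (\<i> * \<theta> * (x - E X))\<close> a first order expansion turns the right-hand side into
  \<open>\<i> * \<theta> * q * E (drift * g X)\<close> plus a remainder, where \<open>drift\<close> is the sum of all shifts.  The choice
  \<open>g x = x\<close> shows \<open>q * E drift = Var X\<close>.  Hence, as soon as \<open>drift\<close> is concentrated and the remainder is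
  small, the characteristic function \<open>\<phi>\<close> of the standardized count nearly satisfies \<open>\<phi>' t = - t * \<phi> t\<close>
  and is close to \<open>exp (- (t^2) / 2)\<close> (\<open>stein_char_bound\<close>); Levy's continuity theorem finishes the proof.

  Since \<open>n\<close> may grow arbitrarily fast, the estimates must also cover the regime in which the variance
  is dominated by pairs of cliques sharing three vertices.  There, bounding the interaction of
  cliques that share two vertices by absolute values is too crude; it is essential that, by the
  symmetry between the colours, two cliques sharing a single edge are uncorrelated.

  \<^item> Concentration of \<open>drift\<close>: it is a linear combination of variables of the form "the edges of \<open>B\<close>
    outside \<open>R\<close> have one colour", and their covariances are dominated by multiples of those of the \<open>I B\<close>.
    So \<open>Var drift\<close> is bounded by a multiple of \<open>Var X\<close>, without any computation of fourth moments
    (\<open>variance_drift\<close>).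

  \<^item> Remainder: \<open>shift A col\<close> is split according to \<open>r = card (A \<inter> B)\<close>, where \<open>B\<close> runs through the affected
    cliques.  For \<open>r = 2\<close> the second moment is small because of the cancellation just mentioned
    (\<open>expect_shift_part_2\<close>); for \<open>r = 3\<close> the second moment is at most of order \<open>(q * T)^2\<close>,
    with \<open>T\<close> as below (\<open>expect_shift_part_3\<close>); for \<open>B = A\<close> the contribution is at most \<open>2\<close>; and for \<open>4 \<le> r < k\<close> already
    the first moment is negligible (\<open>expect_abs_shift_part_mid\<close>).

  All bounds are expressed in the numbers
  \<open>w r = (k choose r) * ((n - k) choose (k - r)) * 2 ^ (r choose 2)\<close>, which measure how often two cliques share \<open>r\<close>
  vertices, weighted by the resulting increase of the joint probability.  With \<open>T = (\<Sum>r=3..k. w r)\<close>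
  the variance is \<open>q\<^sup>2 * (n choose k) * T\<close> up to constant factors, and the theorem reduces to three limits:
  \<open>T\<close> is of smaller order than \<open>n choose k\<close>, \<open>k^2 * w 2\<close> is of smaller order than the square root of
  \<open>(n choose k) * T\<close>, and the middle weights \<open>w 4, \<dots>, w (k - 1)\<close> are negligible against \<open>w 3 + w k\<close>
  (\<open>overlap_asymptotics\<close>).  The constant in the hypothesis on \<open>n\<close> matters only for
  \<open>w k = 2 ^ (k choose 2)\<close> being of smaller order than \<open>n choose k\<close>, which means that \<open>E X\<close> tends to infinity.
\<close>

section \<open>Approximate Stein identities for characteristic functions\<close>

text \<open>
  The hypothesis says that \<open>\<phi>' t = - t * \<phi> t\<close> up to \<open>\<delta> * (\<bar>t\<bar> + t\<^sup>2)\<close> for the characteristic function \<open>\<phi>\<close>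
  of \<open>W\<close>, because \<open>\<phi>' t = \<i> * E (W * exp (\<i> * t * W))\<close>.  So \<open>exp (t\<^sup>2 / 2) * \<phi> t\<close> is nearly constant, and the
  mean value inequality compares it with its value \<open>1\<close> at the origin.
\<close>
lemma stein_char_bound:
  fixes P :: "'a pmf" and W :: "'a \<Rightarrow> real"
  assumes fin: "finite (set_pmf P)" and d: "\<delta> \<ge> 0"
  assumes stein: "\<And>t. cmod (measure_pmf.expectation P (\<lambda>\<omega>. complex_of_real (W \<omega>) * iexp (t * W \<omega>))
        - \<i> * t * measure_pmf.expectation P (\<lambda>\<omega>. iexp (t * W \<omega>))) \<le> \<delta> * (\<bar>t\<bar> + t\<^sup>2)"
  shows "cmod (char (distr (measure_pmf P) borel W) t - exp (- (t\<^sup>2) / 2)) \<le> \<delta> * (t\<^sup>2 + \<bar>t\<bar> ^ 3)"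
proof -
  define \<phi> where "\<phi> t = measure_pmf.expectation P (\<lambda>\<omega>. iexp (t * W \<omega>))" for t
  define \<psi> where "\<psi> t = measure_pmf.expectation P (\<lambda>\<omega>. complex_of_real (W \<omega>) * iexp (t * W \<omega>))" for t
  have char: "char (distr (measure_pmf P) borel W) t = \<phi> t"
    by (simp add: char_def \<phi>_def integral_distr)
  have \<phi>_sum: "\<phi> t = (\<Sum>\<omega>\<in>set_pmf P. pmf P \<omega> *\<^sub>R iexp (t * W \<omega>))" for t
    unfolding \<phi>_def by (rule integral_measure_pmf[OF fin]) auto
  have \<psi>_sum: "\<psi> t = (\<Sum>\<omega>\<in>set_pmf P. pmf P \<omega> *\<^sub>R (complex_of_real (W \<omega>) * iexp (t * W \<omega>)))" for t
    unfolding \<psi>_def by (rule integral_measure_pmf[OF fin]) auto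
  have der_exp: "((\<lambda>t. iexp (t * w)) has_vector_derivative \<i> * (complex_of_real w * iexp (t * w))) (at t within S)" 
    for w t S
  proof -
    have "((\<lambda>z. exp (\<i> * (z * complex_of_real w))) has_field_derivative
        \<i> * complex_of_real w * exp (\<i> * (complex_of_real t * complex_of_real w))) (at (complex_of_real t))"
      by (auto intro!: derivative_eq_intros)
    from has_vector_derivative_real_field[OF this]
    show ?thesis by (simp add: o_def mult_ac)
  qed
  have der: "(\<phi> has_vector_derivative \<i> * \<psi> t) (at t within S)" for t S
  proof -
    have "((\<lambda>t. \<Sum>\<omega>\<in>set_pmf P. pmf P \<omega> *\<^sub>R iexp (t * W \<omega>)) has_vector_derivative
        (\<Sum>\<omega>\<in>set_pmf P. pmf P \<omega> *\<^sub>R (\<i> * (complex_of_real (W \<omega>) * iexp (t * W \<omega>))))) (at t within S)"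
      by (intro has_vector_derivative_sum bounded_linear.has_vector_derivative[OF bounded_linear_scaleR_right] der_exp)
    thus ?thesis by (simp add: \<phi>_sum[abs_def] \<psi>_sum sum_distrib_left)
  qed
  have s: "cmod (\<psi> t - \<i> * t * \<phi> t) \<le> \<delta> * (\<bar>t\<bar> + t\<^sup>2)" for t
    using stein[of t] by (simp add: \<phi>_def \<psi>_def)
  \<comment> \<open>The integrating factor of the equation \<open>\<phi>' t = - t * \<phi> t\<close>.\<close>
  define f where "f t = exp (t\<^sup>2 / 2) *\<^sub>R \<phi> t" for t
  have f0: "f 0 = 1" by (simp add: f_def \<phi>_def)
  have f_der: "(f has_vector_derivative exp (x\<^sup>2 / 2) *\<^sub>R (\<i> * (\<psi> x - \<i> * x * \<phi> x))) (at x within S)" for x S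
  proof -
    have e: "((\<lambda>x::real. exp (x\<^sup>2 / 2)) has_real_derivative x * exp (x\<^sup>2 / 2)) (at x within S)"
      by (auto intro!: derivative_eq_intros)
    have "(f has_vector_derivative exp (x\<^sup>2 / 2) *\<^sub>R (\<i> * \<psi> x) + (x * exp (x\<^sup>2 / 2)) *\<^sub>R \<phi> x) (at x within S)"
      unfolding f_def by (rule has_vector_derivative_scaleR[OF e der])
    also have "exp (x\<^sup>2 / 2) *\<^sub>R (\<i> * \<psi> x) + (x * exp (x\<^sup>2 / 2)) *\<^sub>R \<phi> x
       = exp (x\<^sup>2 / 2) *\<^sub>R (\<i> * (\<psi> x - \<i> * x * \<phi> x))"
      by (simp add: scaleR_conv_of_real algebra_simps)
    finally show ?thesis .
  qed
  define B where "B = exp (t\<^sup>2 / 2) * (\<delta> * (\<bar>t\<bar> + t\<^sup>2))"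
  have "norm (f t - f 0) \<le> B * norm (t - 0)"
  proof (rule differentiable_bound[where S = "{-\<bar>t\<bar>..\<bar>t\<bar>}"])
    fix x assume x: "x \<in> {-\<bar>t\<bar>..\<bar>t\<bar>}"
    show "(f has_derivative (\<lambda>h. h *\<^sub>R (exp (x\<^sup>2 / 2) *\<^sub>R (\<i> * (\<psi> x - \<i> * x * \<phi> x)))))
            (at x within {-\<bar>t\<bar>..\<bar>t\<bar>})"
      using f_der unfolding has_vector_derivative_def .
    have xt: "\<bar>x\<bar> \<le> \<bar>t\<bar>" using x by auto
    hence xt2: "x\<^sup>2 \<le> t\<^sup>2" by (simp add: abs_le_square_iff)
    have "onorm (\<lambda>h. h *\<^sub>R (exp (x\<^sup>2 / 2) *\<^sub>R (\<i> * (\<psi> x - \<i> * x * \<phi> x))))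
        \<le> norm (exp (x\<^sup>2 / 2) *\<^sub>R (\<i> * (\<psi> x - \<i> * x * \<phi> x)))"
      by (rule onorm_le) (simp add: abs_mult mult_ac)
    also have "\<dots> = exp (x\<^sup>2 / 2) * cmod (\<psi> x - \<i> * x * \<phi> x)"
      by (simp add: norm_mult)
    also have "\<dots> \<le> exp (t\<^sup>2 / 2) * (\<delta> * (\<bar>x\<bar> + x\<^sup>2))"
      using s[of x] xt2 by (intro mult_mono) auto
    also have "\<dots> \<le> B"
      unfolding B_def using d xt xt2 by (intro mult_left_mono add_mono) auto
    finally show "onorm (\<lambda>h. h *\<^sub>R (exp (x\<^sup>2 / 2) *\<^sub>R (\<i> * (\<psi> x - \<i> * x * \<phi> x)))) \<le> B" .
  qed auto
  hence fB: "cmod (f t - 1) \<le> B * \<bar>t\<bar>" by (simp add: f0)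
  have "\<phi> t - exp (- (t\<^sup>2) / 2) = exp (- (t\<^sup>2) / 2) *\<^sub>R (f t - 1)"
    by (simp add: f_def scaleR_conv_of_real exp_minus field_simps)
  hence "cmod (\<phi> t - exp (- (t\<^sup>2) / 2)) = exp (- (t\<^sup>2) / 2) * cmod (f t - 1)"
    by (metis norm_scaleR abs_exp_cancel)
  also have "\<dots> \<le> exp (- (t\<^sup>2) / 2) * (B * \<bar>t\<bar>)"
    by (intro mult_left_mono fB) auto
  also have "\<dots> = \<delta> * (t\<^sup>2 + \<bar>t\<bar> ^ 3)"
    by (simp add: B_def exp_minus field_simps power2_eq_square power3_eq_cube)
  finally show ?thesis by (simp add: char)
qed

text \<open>
  A Taylor remainder that is quadratic in one part of the increment and only linear in the other.
  It is used for increments consisting of a part with small second moment and a part of which only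
  the first absolute moment is controlled.
\<close>
lemma iexp_remainder_add:
  "cmod (iexp (a + b) - 1 - \<i> * (a + b)) \<le> a\<^sup>2 / 2 + 2 * \<bar>b\<bar>"
proof -
  have a: "cmod (iexp a - 1 - \<i> * a) \<le> a\<^sup>2 / 2"
    using iexp_approx1[of a 1] by (simp add: power2_eq_square algebra_simps)
  have b: "cmod (iexp b - 1) \<le> \<bar>b\<bar>"
    using iexp_approx1[of b 0] by simp
  have "iexp (a + b) - 1 - \<i> * (a + b) = (iexp a - 1 - \<i> * a) + iexp a * (iexp b - 1) - \<i> * b"
    by (simp add: exp_add algebra_simps)
  also have "cmod \<dots> \<le> cmod (iexp a - 1 - \<i> * a) + cmod (iexp a * (iexp b - 1)) + cmod (\<i> * b)"
    by (rule order.trans[OF norm_triangle_ineq4 add_right_mono[OF norm_triangle_ineq]])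
  also have "\<dots> \<le> a\<^sup>2 / 2 + \<bar>b\<bar> + \<bar>b\<bar>"
    using a b by (intro add_mono) (simp_all add: norm_mult)
  finally show ?thesis by simp
qed

section \<open>Asymptotics of the overlap weights\<close>

text \<open>
  For a fixed \<open>k\<close>-subset \<open>A\<close> of an \<open>n\<close>-set, the two binomial coefficients count the \<open>k\<close>-subsets that meet
  \<open>A\<close> in \<open>r\<close> vertices.  The power of two is the factor by which the probability that both sets are red
  exceeds the product of the two probabilities.
\<close>
definition overlap_weight :: "nat \<Rightarrow> nat \<Rightarrow> nat \<Rightarrow> real" where
  "overlap_weight n k r = real (k choose r) * real ((n - k) choose (k - r)) * 2 ^ (r choose 2)"

lemma overlap_weight_nonneg: "overlap_weight n k r \<ge> 0"
  by (simp add: overlap_weight_def)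

lemma Suc_binomial_Suc: "Suc j * (m choose Suc j) = (m - j) * (m choose j)"
  by (metis binomial_absorption binomial_absorb_comp)

lemma two_times_choose_two: "2 * (m choose 2) = m * (m - 1)"
proof -
  have "even (m * (m - 1))" by (cases "even m") auto
  thus ?thesis by (simp add: choose_two)
qed

text \<open>
  The ratio of consecutive weights, cleared of denominators.  The next two lemmas bound it from
  both sides by \<open>2 ^ r\<close> times a factor that does not depend on \<open>r\<close>.
\<close>
lemma overlap_weight_Suc:
  assumes "r < k" "2 * k \<le> n"
  shows "overlap_weight n k (Suc r) * (real r + 1) * (real n - 2 * real k + real r + 1)
       = overlap_weight n k r * (real k - real r)\<^sup>2 * 2 ^ r"
proof -
  have 1: "real (k choose Suc r) * (real r + 1) = real (k choose r) * (real k - real r)"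
  proof -
    have "real (Suc r * (k choose Suc r)) = real ((k - r) * (k choose r))"
      by (simp only: Suc_binomial_Suc)
    thus ?thesis using assms by (simp add: of_nat_diff algebra_simps)
  qed
  have 2: "real ((n - k) choose (k - Suc r)) * (real n - 2 * real k + real r + 1)
         = real ((n - k) choose (k - r)) * (real k - real r)"
  proof -
    obtain j where j: "k = Suc (j + r)" using assms(1) less_iff_Suc_add by (metis add.commute)
    have "real (Suc j) * real ((n - k) choose Suc j) = real (n - k - j) * real ((n - k) choose j)"
      by (metis Suc_binomial_Suc of_nat_mult)
    moreover have "real (n - k - j) = real n - 2 * real k + real r + 1"
      using assms by (simp add: j of_nat_diff)
    moreover have "k - Suc r = j" "k - r = Suc j" "real k - real r = real (Suc j)"
      by (simp_all add: j)
    ultimately show ?thesis by (simp only: mult.commute)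
  qed
  have 3: "(2::real) ^ (Suc r choose 2) = 2 ^ r * 2 ^ (r choose 2)"
    by (simp add: numeral_2_eq_2 power_add)
  have "overlap_weight n k (Suc r) * (real r + 1) * (real n - 2 * real k + real r + 1)
     = (real (k choose Suc r) * (real r + 1)) 
       * (real ((n - k) choose (k - Suc r)) * (real n - 2 * real k + real r + 1)) * (2 ^ r * 2 ^ (r choose 2))"
    by (simp add: overlap_weight_def 3)
  also have "\<dots> = overlap_weight n k r * (real k - real r)\<^sup>2 * 2 ^ r"
    by (simp only: 1 2) (simp add: overlap_weight_def power2_eq_square)
  finally show ?thesis .
qed

lemma overlap_weight_Suc_le:
  assumes "r < k" "4 * k \<le> n"
  shows "overlap_weight n k (Suc r) \<le> overlap_weight n k r * (2 * real k ^ 2 / real n * 2 ^ r)"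
proof -
  have n: "real n > 0" "4 * real k \<le> real n" using assms by linarith+
  have a: "real n / 2 \<le> (real r + 1) * (real n - 2 * real k + real r + 1)"
  proof -
    have "1 * (real n / 2) \<le> (real r + 1) * (real n - 2 * real k + real r + 1)"
      using n by (intro mult_mono) auto
    thus ?thesis by simp
  qed
  have "overlap_weight n k (Suc r) * (real n / 2)
      \<le> overlap_weight n k (Suc r) * ((real r + 1) * (real n - 2 * real k + real r + 1))"
    by (intro mult_left_mono a overlap_weight_nonneg)
  also have "\<dots> = overlap_weight n k r * (real k - real r)\<^sup>2 * 2 ^ r"
    using overlap_weight_Suc[of r k n] assms by (simp add: mult.assoc)
  also have "\<dots> \<le> overlap_weight n k r * (real k)\<^sup>2 * 2 ^ r"
    using assms by (intro mult_right_mono mult_left_mono power_mono overlap_weight_nonneg) auto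
  finally show ?thesis using n by (simp add: field_simps)
qed

lemma overlap_weight_le_Suc:
  assumes "r < k" "2 * k \<le> n"
  shows "overlap_weight n k r \<le> overlap_weight n k (Suc r) * (real k * real n / 2 ^ r)"
proof -
  have k: "1 \<le> (real k - real r)\<^sup>2" using assms by (intro one_le_power) (simp add: of_nat_diff)
  have "overlap_weight n k r * 1 * 2 ^ r \<le> overlap_weight n k r * (real k - real r)\<^sup>2 * 2 ^ r"
    by (intro mult_right_mono mult_left_mono k overlap_weight_nonneg) auto
  also have "\<dots> = overlap_weight n k (Suc r) * ((real r + 1) * (real n - 2 * real k + real r + 1))"
    using overlap_weight_Suc[of r k n] assms by (simp add: mult.assoc)
  also have "\<dots> \<le> overlap_weight n k (Suc r) * (real k * real n)"
    using assms by (intro mult_left_mono mult_mono overlap_weight_nonneg) auto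
  finally show ?thesis by (simp add: field_simps)
qed

lemma sqrt2_power_double: "sqrt 2 ^ (2 * r) = 2 ^ r"
  by (simp add: power_mult)

text \<open>
  Multiply the ratio bounds from \<open>3\<close> up to \<open>r\<close>; the powers of two collect to \<open>2 ^ ((r choose 2) - 3)\<close>, and
  \<open>(r choose 2) - 3 = (r - 3) * (r + 2) / 2\<close>.  This is why powers of \<open>sqrt 2\<close> appear.
\<close>
lemma overlap_weight_from_below:
  assumes "3 \<le> r" "r \<le> k" "4 * k \<le> n"
  shows "overlap_weight n k r \<le> overlap_weight n k 3 * (2 * real k ^ 2 / real n * sqrt 2 ^ (r + 2)) ^ (r - 3)"
proof -
  have "overlap_weight n k r \<le> overlap_weight n k 3 * ((2 * real k ^ 2 / real n) ^ (r - 3) * sqrt 2 ^ ((r - 3) * (r + 2)))"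
    using assms(1,2)
  proof (induction r rule: dec_induct)
    case (step r)
    have e: "sqrt 2 ^ ((Suc r - 3) * (Suc r + 2)) = sqrt 2 ^ ((r - 3) * (r + 2)) * 2 ^ r"
    proof -
      obtain q where q: "r = q + 3" using step by (metis le_add_diff_inverse2)
      have "(Suc r - 3) * (Suc r + 2) = (r - 3) * (r + 2) + 2 * r"
        by (simp add: q algebra_simps)
      thus ?thesis by (simp only: power_add sqrt2_power_double)
    qed
    have f: "Suc r - 3 = Suc (r - 3)" using step by simp
    have "overlap_weight n k (Suc r) \<le> overlap_weight n k r * (2 * real k ^ 2 / real n * 2 ^ r)"
      using step assms by (intro overlap_weight_Suc_le) auto
    also have "\<dots> \<le> overlap_weight n k 3 * ((2 * real k ^ 2 / real n) ^ (r - 3) * sqrt 2 ^ ((r - 3) * (r + 2)))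
           * (2 * real k ^ 2 / real n * 2 ^ r)"
      using step by (intro mult_right_mono) auto
    also have "\<dots> = overlap_weight n k 3 * ((2 * real k ^ 2 / real n) ^ (Suc r - 3) * sqrt 2 ^ ((Suc r - 3) * (Suc r + 2)))"
      unfolding e unfolding f by simp
    finally show ?case .
  qed simp
  moreover have "sqrt 2 ^ ((r - 3) * (r + 2)) = (sqrt 2 ^ (r + 2)) ^ (r - 3)"
    by (metis mult.commute power_mult)
  ultimately show ?thesis by (simp only: power_mult_distrib)
qed

text \<open>
  The same from \<open>r\<close> up to \<open>k\<close>, with \<open>(k choose 2) - (r choose 2) = (k - r) * (k + r - 1) / 2\<close>.
\<close>
lemma overlap_weight_from_above:
  assumes "1 \<le> r" "r \<le> k" "2 * k \<le> n"
  shows "overlap_weight n k r \<le> overlap_weight n k k * (real k * real n / sqrt 2 ^ (k + r - 1)) ^ (k - r)"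
proof -
  have "overlap_weight n k r \<le> overlap_weight n k k * ((real k * real n) ^ (k - r) / sqrt 2 ^ ((k - r) * (k + r - 1)))"
    using assms(2,1)
  proof (induction r rule: inc_induct)
    case (step r)
    obtain j where j: "k = Suc (j + r)" using step(2) less_iff_Suc_add by (metis add.commute)
    have e: "sqrt 2 ^ ((k - r) * (k + r - 1)) = sqrt 2 ^ ((k - Suc r) * (k + Suc r - 1)) * 2 ^ r"
    proof -
      have "(k - r) * (k + r - 1) = (k - Suc r) * (k + Suc r - 1) + 2 * r"
        by (simp add: j algebra_simps)
      thus ?thesis by (simp only: power_add sqrt2_power_double)
    qed
    have f: "k - r = Suc (k - Suc r)" using step by simp
    have "overlap_weight n k r \<le> overlap_weight n k (Suc r) * (real k * real n / 2 ^ r)"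
      using step assms by (intro overlap_weight_le_Suc) auto
    also have "\<dots> \<le> overlap_weight n k k * ((real k * real n) ^ (k - Suc r) / sqrt 2 ^ ((k - Suc r) * (k + Suc r - 1)))
         * (real k * real n / 2 ^ r)"
      using step by (intro mult_right_mono) auto
    also have "\<dots> = overlap_weight n k k * ((real k * real n) ^ (k - r) / sqrt 2 ^ ((k - r) * (k + r - 1)))"
      unfolding e unfolding f by simp
    finally show ?case .
  qed simp
  moreover have "sqrt 2 ^ ((k - r) * (k + r - 1)) = (sqrt 2 ^ (k + r - 1)) ^ (k - r)"
    by (metis mult.commute power_mult)
  ultimately show ?thesis by (simp only: power_divide)
qed

text \<open>
  Compare \<open>n\<close> with the threshold \<open>4 * k^4 * sqrt 2 ^ (r + 2)\<close>.  Above it, the base of the power in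
  \<open>overlap_weight_from_below\<close> is at most \<open>1 / k^2\<close>.  Below it, the base of the power in
  \<open>overlap_weight_from_above\<close> is at most \<open>4 * k^5 * sqrt 2 ^ (3 - k)\<close>.  In both cases the exponent is at
  least \<open>1\<close>, so every intermediate weight is small against one of the two extreme ones.
\<close>
lemma overlap_weight_mid_le:
  assumes r: "4 \<le> r" "r < k" and n: "4 * k \<le> n" and small: "4 * real k ^ 5 * sqrt 2 ^ 3 / sqrt 2 ^ k \<le> 1"
  shows "overlap_weight n k r \<le> (1 / real k ^ 2 + 4 * real k ^ 5 * sqrt 2 ^ 3 / sqrt 2 ^ k)
           * (overlap_weight n k 3 + overlap_weight n k k)"
proof -
  have k: "real k \<ge> 1" "real n > 0" using r n by linarith+
  let ?s = "sqrt 2" and ?\<epsilon> = "4 * real k ^ 5 * sqrt 2 ^ 3 / sqrt 2 ^ k"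
  have pow: "x ^ m \<le> x" if "0 \<le> x" "x \<le> 1" "m \<ge> 1" for x :: real and m
    using power_decreasing[of 1 m x] that by simp
  show ?thesis
  proof (cases "4 * real k ^ 4 * ?s ^ (r + 2) \<le> real n")
    case True
    have k2: "1 / real k ^ 2 \<le> 1" using k by (simp add: field_simps)
    have "overlap_weight n k r \<le> overlap_weight n k 3 * (2 * real k ^ 2 / real n * ?s ^ (r + 2)) ^ (r - 3)"
      using r n by (intro overlap_weight_from_below) auto
    also have "\<dots> \<le> overlap_weight n k 3 * (1 / real k ^ 2) ^ (r - 3)"
    proof (intro mult_left_mono power_mono overlap_weight_nonneg)
      have "2 * real k ^ 4 * ?s ^ (r + 2) \<le> real n"
      proof -
        have "0 \<le> real k ^ 4 * ?s ^ (r + 2)" by simp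
        thus ?thesis using True by linarith
      qed
      thus "2 * real k ^ 2 / real n * ?s ^ (r + 2) \<le> 1 / real k ^ 2"
        using k by (simp add: field_simps flip: power_add)
    qed simp
    also have "\<dots> \<le> overlap_weight n k 3 * (1 / real k ^ 2)"
      using k k2 r by (intro mult_left_mono pow overlap_weight_nonneg) auto
    also have "\<dots> \<le> (overlap_weight n k 3 + overlap_weight n k k) * (1 / real k ^ 2 + ?\<epsilon>)"
      using k by (intro mult_mono add_increasing add_increasing2 overlap_weight_nonneg) (auto simp: overlap_weight_nonneg)
    finally show ?thesis by (simp add: mult.commute)
  next
    case False
    have "overlap_weight n k r \<le> overlap_weight n k k * (real k * real n / ?s ^ (k + r - 1)) ^ (k - r)"
      using r n by (intro overlap_weight_from_above) auto
    also have "\<dots> \<le> overlap_weight n k k * ?\<epsilon> ^ (k - r)"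
    proof (intro mult_left_mono power_mono overlap_weight_nonneg)
      have "real k * real n \<le> real k * (4 * real k ^ 4 * ?s ^ (r + 2))"
        using False by (intro mult_left_mono) auto
      also have "\<dots> = 4 * real k ^ 5 * ?s ^ (r + 2)" by (simp add: eval_nat_numeral)
      finally have "real k * real n / ?s ^ (k + r - 1) \<le> 4 * real k ^ 5 * ?s ^ (r + 2) / ?s ^ (k + r - 1)"
        by (intro divide_right_mono) auto
      also have "\<dots> = ?\<epsilon>"
      proof -
        have e: "?s ^ (r + 2) * ?s ^ k = ?s ^ 3 * ?s ^ (k + r - 1)"
        proof -
          have "(r + 2) + k = 3 + (k + r - 1)" using r by simp
          thus ?thesis by (simp only: flip: power_add)
        qed
        thus ?thesis by (simp add: frac_eq_eq)
      qed
      finally show "real k * real n / ?s ^ (k + r - 1) \<le> ?\<epsilon>" .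
    qed simp
    also have "\<dots> \<le> overlap_weight n k k * ?\<epsilon>"
      using small r by (intro mult_left_mono pow overlap_weight_nonneg) auto
    also have "\<dots> \<le> (overlap_weight n k 3 + overlap_weight n k k) * (1 / real k ^ 2 + ?\<epsilon>)"
      using k by (intro mult_mono add_increasing add_increasing2 overlap_weight_nonneg) (auto simp: overlap_weight_nonneg)
    finally show ?thesis by (simp add: mult.commute)
  qed
qed

text \<open>
  A random \<open>k\<close>-set contains two given vertices with probability at most \<open>k^2 / n^2\<close>, and \<open>k^2\<close> bounds
  the remaining factor \<open>2 * (k choose 2)\<close>.
\<close>
lemma overlap_weight_2_le:
  assumes "2 \<le> k" "2 * k \<le> n"
  shows "overlap_weight n k 2 \<le> real k ^ 4 / real n ^ 2 * real (n choose k)"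
proof -
  obtain j where j: "k = Suc (Suc j)" using assms(1) by (metis Suc_le_D numeral_2_eq_2 Suc_le_mono)
  obtain m where m: "n = Suc (Suc m)" using assms by (metis Suc_le_D numeral_2_eq_2 Suc_le_mono le_trans le_add2 mult_2)
  have "k * ((k - 1) * (n choose k)) = n * ((n - 1) * ((n - 2) choose (k - 2)))"
    using Suc_times_binomial_eq[of "Suc m" "Suc j"] Suc_times_binomial_eq[of m j]
    by (simp add: j m algebra_simps del: binomial_Suc_Suc)
  from arg_cong[OF this, of real] have eq: "real k * ((real k - 1) * real (n choose k))
      = real n * ((real n - 1) * real ((n - 2) choose (k - 2)))"
    using assms by (simp add: of_nat_diff del: binomial_Suc_Suc)
  have absorb: "real ((n - 2) choose (k - 2)) = real k * (real k - 1) / (real n * (real n - 1)) * real (n choose k)"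
  proof -
    have "real n * (real n - 1) \<noteq> 0" using assms by auto
    thus ?thesis using eq by (simp add: field_simps del: binomial_Suc_Suc)
  qed
  have frac: "(real k - 1) / (real n - 1) \<le> real k / real n"
    using assms by (simp add: field_simps j m)
  have "overlap_weight n k 2 = real k * (real k - 1) * real ((n - k) choose (k - 2))"
  proof -
    have "real (k choose 2) = real k * (real k - 1) / 2"
      using arg_cong[OF two_times_choose_two[of k], of real] assms by (simp add: of_nat_diff)
    thus ?thesis by (simp add: overlap_weight_def)
  qed
  also have "\<dots> \<le> real k * real k * real ((n - 2) choose (k - 2))"
    using assms by (intro mult_mono) (auto intro!: binomial_right_mono)
  also have "\<dots> = real k * real k * (real k / real n * ((real k - 1) / (real n - 1)) * real (n choose k))"
    unfolding absorb by simp
  also have "\<dots> \<le> real k * real k * (real k / real n * (real k / real n) * real (n choose k))"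
    using frac by (intro mult_left_mono mult_right_mono) auto
  also have "\<dots> = real k ^ 4 / real n ^ 2 * real (n choose k)"
    by (simp add: eval_nat_numeral)
  finally show ?thesis .
qed

text \<open>
  Stirling's bound up to the factor \<open>sqrt k\<close>.  The induction step is \<open>exp 1 \<le> (1 + 1 / k) ^ (k + 1)\<close>.
\<close>
lemma fact_le_exp: "fact (Suc k) \<le> exp 1 * real (Suc k) * (real (Suc k) / exp 1) ^ Suc k"
proof (induction k)
  case (Suc k)
  define a b m where "a = real (Suc k)" and "b = real (Suc (Suc k))" and "m = Suc (Suc k)"
  have ab: "a > 0" "b > 0" "b = a + 1" "real m = b" by (simp_all add: a_def b_def m_def)
  have "1 + (- 1 / b) \<le> exp (- 1 / b)"
    by (rule exp_ge_add_one_self)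
  hence "a / b \<le> exp (- 1 / b)"
    using ab by (simp add: field_simps)
  hence "(a / b) ^ m \<le> exp (- 1 / b) ^ m"
    using ab by (intro power_mono) auto
  also have "\<dots> = exp (- 1)"
    using ab by (simp flip: exp_of_nat_mult)
  finally have *: "exp 1 * a ^ m \<le> b ^ m"
    using ab by (simp add: power_divide exp_minus field_simps)
  have "fact m = b * fact (Suc k)"
    by (simp only: m_def b_def fact_Suc[of "Suc k"])
  also have "\<dots> \<le> b * (exp 1 * a * (a / exp 1) ^ Suc k)"
    using Suc ab by (intro mult_left_mono) (auto simp: a_def)
  also have "\<dots> = b * exp 1 * (exp 1 * a ^ m) / exp 1 ^ m"
    by (simp add: power_divide m_def field_simps)
  also have "\<dots> \<le> b * exp 1 * b ^ m / exp 1 ^ m"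
    using * ab by (intro divide_right_mono mult_left_mono) auto
  also have "\<dots> = exp 1 * b * (b / exp 1) ^ m"
    by (simp add: power_divide)
  finally show ?case by (simp only: m_def b_def)
qed simp

lemma diff_power_le_binomial:
  assumes "k \<le> n"
  shows "(real n - real k) ^ k \<le> real (n choose k) * fact k"
proof -
  have "(real n - real k) ^ k = (\<Prod>i\<in>{0..<k}. real n - real k)" by simp
  also have "\<dots> \<le> (\<Prod>i\<in>{0..<k}. real n - real i)"
    using assms by (intro prod_mono) auto
  also have "\<dots> = real (n choose k) * fact k"
    by (simp add: binomial_gbinomial gbinomial_prod_rev)
  finally show ?thesis .
qed

text \<open>
  This is where the constant \<open>sqrt 2 / e\<close> in the lower bound on \<open>n\<close> enters.  At the threshold,
  \<open>n = sqrt 2 * (k / e) * sqrt 2 ^ k = 2 * (k / e) * sqrt 2 ^ (k - 1)\<close>, so that \<open>n choose k\<close>, which is about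
  \<open>(e * n / k) ^ k\<close>, exceeds \<open>2 ^ (k choose 2) = (sqrt 2 ^ (k - 1)) ^ k\<close> by about \<open>2 ^ k\<close>.  The constant
  \<open>3 / 2\<close> instead of \<open>2\<close> leaves room for the \<open>o(1)\<close> and for replacing \<open>n\<close> by \<open>n - k\<close>.
\<close>
lemma two_power_le_binomial:
  assumes k: "1 \<le> k" "k \<le> n" and n: "real n - real k \<ge> 3 / 2 * (real k / exp 1 * sqrt 2 ^ (k - 1))"
  shows "2 ^ (k choose 2) \<le> exp 1 * real k * (2 / 3) ^ k * real (n choose k)"
proof -
  let ?z = "real k / exp 1 * sqrt 2 ^ (k - 1)"
  have k1: "Suc (k - 1) = k" using k by simp
  have two: "(2::real) ^ (k choose 2) = (sqrt 2 ^ (k - 1)) ^ k"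
  proof -
    have "2 * (k choose 2) = (k - 1) * k" by (simp add: two_times_choose_two mult.commute)
    thus ?thesis by (simp only: flip: sqrt2_power_double power_mult)
  qed
  have "2 ^ (k choose 2) * (3 / 2 * (real k / exp 1)) ^ k = (3 / 2 * ?z) ^ k"
    by (simp add: two power_mult_distrib power_divide mult_ac)
  also have "\<dots> \<le> (real n - real k) ^ k" using n by (intro power_mono) auto
  also have "\<dots> \<le> real (n choose k) * fact k" using k by (intro diff_power_le_binomial)
  also have "\<dots> \<le> real (n choose k) * (exp 1 * real k * (real k / exp 1) ^ k)"
    using fact_le_exp[of "k - 1"] unfolding k1 by (intro mult_left_mono) auto
  also have "\<dots> = (exp 1 * real k * (2 / 3) ^ k * real (n choose k)) * (3 / 2 * (real k / exp 1)) ^ k"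
  proof -
    have "(2 / 3) ^ k * (3 / 2 * (real k / exp 1)) ^ k = (real k / exp 1) ^ k"
      by (simp flip: power_mult_distrib)
    from this[symmetric] show ?thesis by (simp only: mult_ac)
  qed
  finally have *: "2 ^ (k choose 2) * (3 / 2 * (real k / exp 1)) ^ k
      \<le> (exp 1 * real k * (2 / 3) ^ k * real (n choose k)) * (3 / 2 * (real k / exp 1)) ^ k" .
  have "0 < 3 / 2 * (real k / exp 1)" using k by simp
  hence "0 < (3 / 2 * (real k / exp 1)) ^ k" by (rule zero_less_power)
  from mult_right_le_imp_le[OF * this] show ?thesis .
qed


definition overlap_sum :: "nat \<Rightarrow> nat \<Rightarrow> real" where
  "overlap_sum n k = (\<Sum>r=3..k. overlap_weight n k r)"

definition overlap_mid :: "nat \<Rightarrow> nat \<Rightarrow> real" where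
  "overlap_mid n k = (\<Sum>r=4..<k. overlap_weight n k r)"

lemma overlap_sum_split:
  assumes "4 \<le> k"
  shows "overlap_sum n k = overlap_weight n k 3 + overlap_mid n k + overlap_weight n k k"
proof -
  have "{3..k} = insert 3 (insert k {4..<k})" using assms by auto
  thus ?thesis using assms by (simp add: overlap_sum_def overlap_mid_def)
qed

lemma overlap_mid_nonneg: "overlap_mid n k \<ge> 0"
  unfolding overlap_mid_def by (intro sum_nonneg overlap_weight_nonneg)

lemma overlap_weight_self: "overlap_weight n k k = 2 ^ (k choose 2)"
  by (simp add: overlap_weight_def)

lemma overlap_mid_le:
  assumes k: "4 \<le> k" and n: "4 * k \<le> n" and small: "4 * real k ^ 5 * sqrt 2 ^ 3 / sqrt 2 ^ k \<le> 1"
  shows "overlap_mid n k \<le> (1 / real k + 4 * real k ^ 6 * sqrt 2 ^ 3 / sqrt 2 ^ k)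
           * (overlap_weight n k 3 + overlap_weight n k k)"
proof -
  let ?c = "1 / real k ^ 2 + 4 * real k ^ 5 * sqrt 2 ^ 3 / sqrt 2 ^ k"
  let ?w = "overlap_weight n k 3 + overlap_weight n k k"
  have w: "?w \<ge> 0" by (intro add_nonneg_nonneg overlap_weight_nonneg)
  have "overlap_mid n k \<le> (\<Sum>r=4..<k. ?c * ?w)"
    unfolding overlap_mid_def using assms by (intro sum_mono overlap_weight_mid_le) auto
  also have "\<dots> = real (k - 4) * (?c * ?w)" by simp
  also have "\<dots> \<le> real k * (?c * ?w)"
    using w by (intro mult_right_mono mult_nonneg_nonneg) auto
  also have "\<dots> = (1 / real k + 4 * real k ^ 6 * sqrt 2 ^ 3 / sqrt 2 ^ k) * ?w"
    using k by (simp add: field_simps eval_nat_numeral)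
  finally show ?thesis .
qed

lemma overlap_sum_pos:
  assumes "4 \<le> k"
  shows "overlap_sum n k > 0"
proof -
  have "overlap_weight n k k > 0" by (simp add: overlap_weight_self)
  thus ?thesis
    using overlap_sum_split[OF assms, of n] overlap_weight_nonneg[of n k 3] overlap_mid_nonneg[of n k]
    by linarith
qed

text \<open>
  The three limits on which the error bound rests: the middle weights are negligible, the variance
  is small against the squared mean (the third statement), and the pairs of cliques sharing two
  vertices are harmless (the fourth).
\<close>
lemma overlap_asymptotics:
  fixes n :: "nat \<Rightarrow> nat" and \<epsilon> :: "nat \<Rightarrow> real"
  assumes eps: "\<epsilon> \<longlonglongrightarrow> 0"
    and n: "\<forall>\<^sub>F k in sequentially. real (n k) \<ge> sqrt 2 * real k / exp 1 * 2 powr (real k / 2) * (1 + \<epsilon> k)"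
  shows "\<forall>\<^sub>F k in sequentially. 4 \<le> k \<and> 4 * k \<le> n k"
    and "(\<lambda>k. overlap_mid (n k) k / overlap_sum (n k) k) \<longlonglongrightarrow> 0"
    and "(\<lambda>k. overlap_sum (n k) k / real (n k choose k)) \<longlonglongrightarrow> 0"
    and "(\<lambda>k. real k ^ 4 * overlap_weight (n k) k 2 ^ 2 / (real (n k choose k) * overlap_sum (n k) k)) \<longlonglongrightarrow> 0"
proof -
  have ev_eps: "\<forall>\<^sub>F k in sequentially. 1 + \<epsilon> k \<ge> 9 / 10"
  proof -
    have "\<forall>\<^sub>F k in sequentially. \<epsilon> k > - 1 / 10" using eps by (rule order_tendstoD) simp
    thus ?thesis by eventually_elim simp
  qed
  have s: "2 powr (real k / 2) = sqrt 2 ^ k" for k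
  proof -
    have "sqrt 2 ^ k = (2 powr (1 / 2)) powr real k" by (simp add: powr_realpow powr_half_sqrt)
    thus ?thesis by (simp add: powr_powr)
  qed
  have exp3: "exp (1::real) \<le> 3" by (rule exp_le)
  have big: "\<forall>\<^sub>F k in sequentially. 40 * real k \<le> sqrt 2 ^ k"
    by real_asymp
  have small: "\<forall>\<^sub>F k in sequentially. 4 * real k ^ 5 * sqrt 2 ^ 3 / sqrt 2 ^ k \<le> 1"
    by real_asymp
  have main: "\<forall>\<^sub>F k in sequentially. 4 \<le> k \<and> sqrt 2 ^ k \<le> real (n k) \<and> 40 * k \<le> n k
      \<and> 3 / 2 * (real k / exp 1 * sqrt 2 ^ (k - 1)) \<le> real (n k) - real k"
    using n ev_eps big eventually_ge_at_top[of 4]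
  proof eventually_elim
    case (elim k)
    \<comment> \<open>The bound on \<open>n\<close> is \<open>2 * z * (1 + \<epsilon> k)\<close> for the following \<open>z\<close>.\<close>
    define q where "q = sqrt 2 ^ (k - 1)"
    define z where "z = real k / exp 1 * q"
    have q: "q \<ge> 0" and z: "z \<ge> 0" by (simp_all add: q_def z_def)
    have sk: "sqrt 2 ^ k = sqrt 2 * q" using elim(4) by (cases k) (auto simp: q_def)
    have "sqrt 2 * real k / exp 1 * 2 powr (real k / 2) = (sqrt 2 * sqrt 2) * z"
      by (simp only: s sk z_def) simp
    also have "\<dots> = 2 * z" by simp
    finally have "2 * z * (1 + \<epsilon> k) \<le> real (n k)" using elim(1) by (simp only:)
    moreover have "2 * z * (9 / 10) \<le> 2 * z * (1 + \<epsilon> k)"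
      using elim(2) z by (intro mult_left_mono) auto
    ultimately have nz: "9 / 5 * z \<le> real (n k)" by simp
    \<comment> \<open>The slack factor \<open>9 / 10\<close> is affordable: \<open>9 / 5 * 4 / 3 > 2 > sqrt 2\<close> yields \<open>n \<ge> sqrt 2 ^ k\<close>.\<close>
    have "4 / 3 \<le> real k / exp 1"
      using elim(4) exp3 by (simp add: field_simps)
    hence "4 / 3 * q \<le> z" unfolding z_def using q by (intro mult_right_mono)
    moreover have "sqrt 2 * q \<le> 2 * q"
      using q by (intro mult_right_mono) (auto intro: real_le_lsqrt)
    ultimately have nk: "sqrt 2 ^ k \<le> real (n k)" using nz q sk by linarith
    hence "40 * real k \<le> real (n k)" using elim(3) by linarith
    moreover from this nz have "3 / 2 * z \<le> real (n k) - real k"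
      using z by linarith
    ultimately show ?case using elim(4) nk by (simp add: z_def q_def)
  qed
  show four: "\<forall>\<^sub>F k in sequentially. 4 \<le> k \<and> 4 * k \<le> n k"
    using main by eventually_elim auto
  let ?g = "\<lambda>k::nat. 1 / real k + 4 * real k ^ 6 * sqrt 2 ^ 3 / sqrt 2 ^ k"
  have g0: "?g \<longlonglongrightarrow> 0" by real_asymp
  have mid: "\<forall>\<^sub>F k in sequentially. overlap_mid (n k) k \<le> ?g k * (overlap_weight (n k) k 3 + overlap_weight (n k) k k)"
    using four small by eventually_elim (intro overlap_mid_le, auto)
  show "(\<lambda>k. overlap_mid (n k) k / overlap_sum (n k) k) \<longlonglongrightarrow> 0"
  proof (rule tendsto_sandwich[OF _ _ tendsto_const g0])
    show "\<forall>\<^sub>F k in sequentially. 0 \<le> overlap_mid (n k) k / overlap_sum (n k) k"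
      using four by eventually_elim (auto intro!: divide_nonneg_pos overlap_mid_nonneg overlap_sum_pos)
    show "\<forall>\<^sub>F k in sequentially. overlap_mid (n k) k / overlap_sum (n k) k \<le> ?g k"
      using four mid
    proof eventually_elim
      case (elim k)
      have "?g k * (overlap_weight (n k) k 3 + overlap_weight (n k) k k) \<le> ?g k * overlap_sum (n k) k"
        using elim overlap_mid_nonneg[of "n k" k] by (intro mult_left_mono) (auto simp: overlap_sum_split)
      with elim show ?case by (simp add: pos_divide_le_eq overlap_sum_pos)
    qed
  qed
  have w3: "\<forall>\<^sub>F k in sequentially. overlap_weight (n k) k 2 \<le> real k ^ 4 / real (n k) ^ 2 * real (n k choose k)"
    using four by eventually_elim (intro overlap_weight_2_le, auto)
  let ?h = "\<lambda>k::nat. (1 + ?g k) * (8 * real k ^ 6 / sqrt 2 ^ k + exp 1 * real k * (2 / 3) ^ k)"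
  have h0: "?h \<longlonglongrightarrow> 0"
  proof -
    have 1: "(\<lambda>k::nat. 8 * real k ^ 6 / sqrt 2 ^ k) \<longlonglongrightarrow> 0" by real_asymp
    have 2: "(\<lambda>k. exp 1 * (real k * (2 / 3) ^ k)) \<longlonglongrightarrow> exp 1 * 0"
      by (intro tendsto_mult tendsto_const powser_times_n_limit_0) auto
    show ?thesis
      using tendsto_mult[OF tendsto_add[OF tendsto_const[of 1] g0] tendsto_add[OF 1 2]]
      by (simp add: mult.assoc)
  qed
  show "(\<lambda>k. overlap_sum (n k) k / real (n k choose k)) \<longlonglongrightarrow> 0"
  proof (rule tendsto_sandwich[OF _ _ tendsto_const h0])
    show "\<forall>\<^sub>F k in sequentially. 0 \<le> overlap_sum (n k) k / real (n k choose k)"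
      using four by eventually_elim (auto intro!: divide_nonneg_nonneg less_imp_le[OF overlap_sum_pos])
    show "\<forall>\<^sub>F k in sequentially. overlap_sum (n k) k / real (n k choose k) \<le> ?h k"
      using main mid w3
    proof eventually_elim
      case (elim k)
      let ?C = "real (n k choose k)"
      have C: "?C > 0" using elim by simp
      have n1: "real (n k) \<ge> 1" using elim by linarith
      have snk: "sqrt 2 ^ k \<le> real (n k)" using elim(1) by blast
      have "overlap_weight (n k) k 3 \<le> overlap_weight (n k) k 2 * (2 * real k ^ 2 / real (n k) * 2 ^ 2)"
        using overlap_weight_Suc_le[of 2 k "n k"] elim by (simp add: numeral_3_eq_3)
      also have "\<dots> \<le> real k ^ 4 / real (n k) ^ 2 * ?C * (2 * real k ^ 2 / real (n k) * 2 ^ 2)"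
        using elim by (intro mult_right_mono) auto
      also have "\<dots> = 8 * real k ^ 6 / real (n k) ^ 3 * ?C"
        by (simp add: eval_nat_numeral mult_ac)
      also have "\<dots> \<le> 8 * real k ^ 6 / sqrt 2 ^ k * ?C"
      proof (intro mult_right_mono divide_left_mono)
        have "real (n k) \<le> real (n k) ^ 3" using power_increasing[of 1 3 "real (n k)"] n1 by simp
        with snk show "sqrt 2 ^ k \<le> real (n k) ^ 3" by (rule order.trans)
      qed (use n1 in auto)
      finally have 3: "overlap_weight (n k) k 3 \<le> 8 * real k ^ 6 / sqrt 2 ^ k * ?C" .
      have k: "overlap_weight (n k) k k \<le> exp 1 * real k * (2 / 3) ^ k * ?C"
        unfolding overlap_weight_self using elim by (intro two_power_le_binomial) auto
      have "overlap_sum (n k) k \<le> (1 + ?g k) * (overlap_weight (n k) k 3 + overlap_weight (n k) k k)"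
        using elim by (simp add: overlap_sum_split distrib_right)
      also have "\<dots> \<le> (1 + ?g k) * (8 * real k ^ 6 / sqrt 2 ^ k * ?C + exp 1 * real k * (2 / 3) ^ k * ?C)"
        using 3 k by (intro mult_left_mono add_mono) auto
      also have "\<dots> = ?h k * ?C" by (simp add: algebra_simps)
      finally show ?case using C by (simp add: pos_divide_le_eq)
    qed
  qed
  let ?b = "\<lambda>k::nat. real k ^ 9 / 4 / sqrt 2 ^ k"
  have b0: "?b \<longlonglongrightarrow> 0" by real_asymp
  show "(\<lambda>k. real k ^ 4 * overlap_weight (n k) k 2 ^ 2 / (real (n k choose k) * overlap_sum (n k) k)) \<longlonglongrightarrow> 0"
  proof (rule tendsto_sandwich[OF _ _ tendsto_const b0])
    show "\<forall>\<^sub>F k in sequentially. 0 \<le> real k ^ 4 * overlap_weight (n k) k 2 ^ 2 / (real (n k choose k) * overlap_sum (n k) k)"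
      using four by eventually_elim
        (auto intro!: divide_nonneg_nonneg mult_nonneg_nonneg less_imp_le[OF overlap_sum_pos] overlap_weight_nonneg)
    show "\<forall>\<^sub>F k in sequentially. real k ^ 4 * overlap_weight (n k) k 2 ^ 2 / (real (n k choose k) * overlap_sum (n k) k) \<le> ?b k"
      using main w3
    proof eventually_elim
      case (elim k)
      let ?C = "real (n k choose k)" and ?T = "overlap_sum (n k) k"
      have C: "?C > 0" using elim by simp
      have T: "?T > 0" using elim by (intro overlap_sum_pos) auto
      have n1: "real (n k) \<ge> 1" using elim by linarith
      have snk: "sqrt 2 ^ k \<le> real (n k)" using elim(1) by blast
      have "overlap_weight (n k) k 2 \<le> overlap_weight (n k) k 3 * (real k * real (n k) / 4)"
        using overlap_weight_le_Suc[of 2 k "n k"] elim by (simp add: numeral_3_eq_3)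
      also have "\<dots> \<le> ?T * (real k * real (n k) / 4)"
        using elim overlap_mid_nonneg[of "n k" k] overlap_weight_nonneg[of "n k" k k]
        by (intro mult_right_mono) (auto simp: overlap_sum_split)
      finally have T2: "overlap_weight (n k) k 2 \<le> ?T * (real k * real (n k) / 4)" .
      have "overlap_weight (n k) k 2 * overlap_weight (n k) k 2
          \<le> (real k ^ 4 / real (n k) ^ 2 * ?C) * (?T * (real k * real (n k) / 4))"
        using elim T2 by (intro mult_mono overlap_weight_nonneg) auto
      also have "\<dots> = real k ^ 5 / 4 / real (n k) * (?C * ?T)"
        using n1 by (simp add: field_simps eval_nat_numeral)
      also have "\<dots> \<le> real k ^ 5 / 4 / sqrt 2 ^ k * (?C * ?T)"
        using elim C T n1 by (intro mult_right_mono divide_left_mono) auto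
      finally have "real k ^ 4 * overlap_weight (n k) k 2 ^ 2 \<le> real k ^ 4 * (real k ^ 5 / 4 / sqrt 2 ^ k * (?C * ?T))"
        by (intro mult_left_mono) (auto simp: power2_eq_square)
      also have "\<dots> = ?b k * (?C * ?T)"
        by (simp add: eval_nat_numeral mult_ac)
      finally show ?case using C T by (simp add: pos_divide_le_eq)
    qed
  qed
qed

text \<open>
  The rate at which the Stein identity is shown to hold; \<open>80\<close> is an arbitrary constant large enough
  for the final estimate.
\<close>
definition clt_error :: "nat \<Rightarrow> nat \<Rightarrow> real" where
  "clt_error n k = 80 * (sqrt (overlap_sum n k / real (n choose k))
      + sqrt (real k ^ 4 * overlap_weight n k 2 ^ 2 / (real (n choose k) * overlap_sum n k))
      + overlap_mid n k / overlap_sum n k)"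

lemma clt_error_tendsto_0:
  fixes n :: "nat \<Rightarrow> nat" and \<epsilon> :: "nat \<Rightarrow> real"
  assumes "\<epsilon> \<longlonglongrightarrow> 0"
    and "\<forall>\<^sub>F k in sequentially. real (n k) \<ge> sqrt 2 * real k / exp 1 * 2 powr (real k / 2) * (1 + \<epsilon> k)"
  shows "(\<lambda>k. clt_error (n k) k) \<longlonglongrightarrow> 0"
proof -
  note lim = overlap_asymptotics(2-4)[OF assms]
  have "(\<lambda>k. clt_error (n k) k) \<longlonglongrightarrow> 80 * (sqrt 0 + sqrt 0 + 0)"
    unfolding clt_error_def by (intro tendsto_intros lim)
  thus ?thesis by simp
qed

section \<open>Expectations over a random colouring\<close>

abbreviation expect :: "nat \<Rightarrow> ((nat set \<Rightarrow> bool) \<Rightarrow> 'b) \<Rightarrow> 'b::{banach, second_countable_topology}" where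
  "expect n f \<equiv> measure_pmf.expectation (random_coloring n) f"

lemma finite_random_coloring: "finite (set_pmf (random_coloring n))"
proof -
  have fin: "finite ([{..<n}]\<^bsup>2\<^esup>)" by (simp add: finite_imp_finite_nsets)
  show ?thesis
    unfolding random_coloring_def set_Pi_pmf[OF fin] by (rule finite_PiE_dflt[OF fin]) auto
qed

lemma integrable_random_coloring [simp]:
  fixes f :: "(nat set \<Rightarrow> bool) \<Rightarrow> 'b::{banach, second_countable_topology}"
  shows "integrable (measure_pmf (random_coloring n)) f"
  by (rule integrable_measure_pmf_finite[OF finite_random_coloring])

definition recolor :: "nat set set \<Rightarrow> bool \<Rightarrow> (nat set \<Rightarrow> bool) \<Rightarrow> nat set \<Rightarrow> bool" where
  "recolor F col \<omega> = (\<lambda>e. if e \<in> F then col else \<omega> e)"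

definition all_col :: "nat set set \<Rightarrow> bool \<Rightarrow> (nat set \<Rightarrow> bool) \<Rightarrow> real" where
  "all_col F col \<omega> = of_bool (\<forall>e\<in>F. \<omega> e = col)"

lemma expect_resample_edge:
  fixes g :: "(nat set \<Rightarrow> bool) \<Rightarrow> 'b::{banach, second_countable_topology}"
  assumes "e \<in> [{..<n}]\<^bsup>2\<^esup>"
  shows "expect n (\<lambda>\<omega>. all_col {e} col \<omega> *\<^sub>R g \<omega>) = (1 / 2) *\<^sub>R expect n (\<lambda>\<omega>. g (fun_upd \<omega> e col))"
proof -
  define A where "A = [{..<n}]\<^bsup>2\<^esup> - {e}"
  have A: "finite A" "e \<notin> A" "[{..<n}]\<^bsup>2\<^esup> = insert e A"
    using assms by (auto simp: A_def finite_imp_finite_nsets)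
  let ?Q = "Pi_pmf A False (\<lambda>_. bernoulli_pmf (1 / 2))"
  have finQ: "finite (set_pmf ?Q)"
    unfolding set_Pi_pmf[OF A(1)] by (rule finite_PiE_dflt[OF A(1)]) auto
  have fin2: "finite (set_pmf (?Q \<bind> (\<lambda>f. return_pmf (fun_upd f e b))))" for b
    using finQ by simp
  have *: "expect n h = (\<Sum>b\<in>UNIV. (1 / 2) *\<^sub>R measure_pmf.expectation ?Q (\<lambda>f. h (fun_upd f e b)))"
    for h :: "(nat set \<Rightarrow> bool) \<Rightarrow> 'b"
  proof -
    have "expect n h = measure_pmf.expectation (bernoulli_pmf (1 / 2) \<bind> (\<lambda>y. ?Q \<bind> (\<lambda>f. return_pmf (fun_upd f e y)))) h"
      unfolding random_coloring_def A(3) by (subst Pi_pmf_insert'[OF A(1,2)]) (rule refl)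
    also have "\<dots> = (\<Sum>b\<in>UNIV. pmf (bernoulli_pmf (1 / 2)) b *\<^sub>R measure_pmf.expectation (?Q \<bind> (\<lambda>f. return_pmf (fun_upd f e b))) h)"
      by (rule pmf_expectation_bind) (use fin2 in auto)
    also have "\<dots> = (\<Sum>b\<in>UNIV. (1 / 2) *\<^sub>R measure_pmf.expectation ?Q (\<lambda>f. h (fun_upd f e b)))"
    proof (intro sum.cong refl)
      fix b :: bool
      have "?Q \<bind> (\<lambda>f. return_pmf (fun_upd f e b)) = map_pmf (\<lambda>f. fun_upd f e b) ?Q"
        by (simp add: map_pmf_def)
      thus "pmf (bernoulli_pmf (1 / 2)) b *\<^sub>R measure_pmf.expectation (?Q \<bind> (\<lambda>f. return_pmf (fun_upd f e b))) h
          = (1 / 2) *\<^sub>R measure_pmf.expectation ?Q (\<lambda>f. h (fun_upd f e b))"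
        by (cases b) (simp_all add: pmf_bernoulli_True pmf_bernoulli_False)
    qed
    finally show ?thesis .
  qed
  show ?thesis
    unfolding * by (cases col) (simp_all add: UNIV_bool all_col_def flip: scaleR_add_left)
qed

text \<open>
  Given that the edges of \<open>F\<close> have colour \<open>col\<close>, the remaining edges are still uniform and independent;
  overwriting \<open>F\<close> in an unconditioned colouring therefore has the conditional distribution.
\<close>
lemma expect_all_col_scaleR:
  fixes g :: "(nat set \<Rightarrow> bool) \<Rightarrow> 'b::{banach, second_countable_topology}"
  assumes "F \<subseteq> [{..<n}]\<^bsup>2\<^esup>"
  shows "expect n (\<lambda>\<omega>. all_col F col \<omega> *\<^sub>R g \<omega>) = (1 / 2) ^ card F *\<^sub>R expect n (\<lambda>\<omega>. g (recolor F col \<omega>))"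
proof -
  have "finite F" using assms by (rule finite_subset) (simp add: finite_imp_finite_nsets)
  thus ?thesis using assms
  proof (induction F arbitrary: g rule: finite_induct)
    case empty
    show ?case by (simp add: all_col_def recolor_def)
  next
    case (insert e F)
    have 1: "all_col (insert e F) col \<omega> = all_col {e} col \<omega> * all_col F col \<omega>" for \<omega>
      by (simp add: all_col_def)
    have 2: "all_col F col (fun_upd \<omega> e col) = all_col F col \<omega>" for \<omega>
      using insert(2) by (auto simp: all_col_def intro!: arg_cong[where f = of_bool])
    have 3: "fun_upd (recolor F col \<omega>) e col = recolor (insert e F) col \<omega>" for \<omega>
      by (rule ext) (auto simp: recolor_def fun_upd_def)
    have "expect n (\<lambda>\<omega>. all_col (insert e F) col \<omega> *\<^sub>R g \<omega>)
        = expect n (\<lambda>\<omega>. all_col {e} col \<omega> *\<^sub>R (all_col F col \<omega> *\<^sub>R g \<omega>))"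
      by (simp add: 1)
    also have "\<dots> = (1 / 2) *\<^sub>R expect n (\<lambda>\<omega>. all_col F col \<omega> *\<^sub>R g (fun_upd \<omega> e col))"
      using insert.prems by (subst expect_resample_edge) (auto simp: 2)
    also have "\<dots> = (1 / 2) ^ card (insert e F) *\<^sub>R expect n (\<lambda>\<omega>. g (recolor (insert e F) col \<omega>))"
      using insert by (simp add: 3)
    finally show ?case .
  qed
qed

lemma all_col_recolor_same: "all_col F col (recolor G col \<omega>) = all_col (F - G) col \<omega>"
  by (auto simp: all_col_def recolor_def intro!: arg_cong[where f = of_bool])

lemma all_col_recolor_other:
  assumes "col' \<noteq> col"
  shows "all_col F col' (recolor G col \<omega>) = (if F \<inter> G = {} then all_col F col' \<omega> else 0)"
  using assms by (auto simp: all_col_def recolor_def)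

lemma all_col_nonneg: "all_col F col \<omega> \<ge> 0"
  and all_col_le_1: "all_col F col \<omega> \<le> 1"
  by (simp_all add: all_col_def)

lemma all_col_antimono: "F \<subseteq> G \<Longrightarrow> all_col G col \<omega> \<le> all_col F col \<omega>"
  by (auto simp: all_col_def)

lemma expect_all_col:
  assumes "F \<subseteq> [{..<n}]\<^bsup>2\<^esup>"
  shows "expect n (all_col F col) = (1 / 2) ^ card F"
  using expect_all_col_scaleR[OF assms, of col "\<lambda>_. 1::real"] by simp

lemma finite_edges:
  assumes "F \<subseteq> [{..<n::nat}]\<^bsup>2\<^esup>"
  shows "finite F"
  by (rule finite_subset[OF assms]) (simp add: finite_imp_finite_nsets)

lemma expect_all_col_same:
  assumes "F \<subseteq> [{..<n}]\<^bsup>2\<^esup>" "G \<subseteq> [{..<n}]\<^bsup>2\<^esup>"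
  shows "expect n (\<lambda>\<omega>. all_col F col \<omega> * all_col G col \<omega>) = (1 / 2) ^ (card F + card G) * 2 ^ card (F \<inter> G)"
proof -
  have fin: "finite F" "finite G" using assms by (auto intro: finite_edges)
  have GF: "G - F \<subseteq> [{..<n}]\<^bsup>2\<^esup>" using assms(2) by auto
  have G: "card G = card (G - F) + card (F \<inter> G)"
    using fin by (metis Int_commute card_Int_Diff add.commute)
  have "expect n (\<lambda>\<omega>. all_col F col \<omega> *\<^sub>R all_col G col \<omega>) = (1 / 2) ^ card F * (1 / 2) ^ card (G - F)"
    using assms(1) by (subst expect_all_col_scaleR) (simp_all add: all_col_recolor_same expect_all_col[OF GF])
  also have "\<dots> = (1 / 2) ^ (card F + card G) * 2 ^ card (F \<inter> G)"
    by (simp add: G power_add power_divide)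
  finally show ?thesis by simp
qed

lemma expect_all_col_other:
  assumes "F \<subseteq> [{..<n}]\<^bsup>2\<^esup>" "G \<subseteq> [{..<n}]\<^bsup>2\<^esup>" "col' \<noteq> col"
  shows "expect n (\<lambda>\<omega>. all_col F col \<omega> * all_col G col' \<omega>) = (if F \<inter> G = {} then (1 / 2) ^ (card F + card G) else 0)"
proof -
  have "expect n (\<lambda>\<omega>. all_col F col \<omega> *\<^sub>R all_col G col' \<omega>)
      = (1 / 2) ^ card F * (if F \<inter> G = {} then (1 / 2) ^ card G else 0)"
    using assms by (subst expect_all_col_scaleR) (auto simp: all_col_recolor_other expect_all_col Int_commute)
  thus ?thesis by (simp add: power_add)
qed

text \<open>
  Half the indicator that \<open>F\<close> is monochromatic, if \<open>F\<close> is nonempty.  Averaging over the two colours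
  gives the value \<open>1\<close> for empty \<open>F\<close>, and with it the moment formulas below hold without exceptions.
\<close>
definition mono_half :: "nat set set \<Rightarrow> (nat set \<Rightarrow> bool) \<Rightarrow> real" where
  "mono_half F \<omega> = (all_col F True \<omega> + all_col F False \<omega>) / 2"

lemma two_mono_half: "2 * mono_half F \<omega> = all_col F True \<omega> + all_col F False \<omega>"
  by (simp add: mono_half_def)

text \<open>
  The covariance of \<open>mono_half F\<close> and \<open>mono_half G\<close> relative to the product of their means, as a function of
  \<open>a = card (F \<inter> G)\<close>.  It vanishes for \<open>a = 1\<close>: one common edge does not correlate the two events,
  by the symmetry between the colours.
\<close>
definition excess :: "nat \<Rightarrow> real" where
  "excess a = (if a = 0 then 0 else 2 ^ (a - 1) - 1)"

lemma excess_mono: "a \<le> b \<Longrightarrow> excess a \<le> excess b"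
  by (auto simp: excess_def intro!: power_increasing)

lemma excess_nonneg: "excess a \<ge> 0"
  by (simp add: excess_def)

lemma excess_le: "excess a \<le> 2 ^ a / 2"
  by (cases a) (auto simp: excess_def)

lemma excess_ge: "a \<ge> 3 \<Longrightarrow> 3 / 8 * 2 ^ a \<le> excess a"
proof -
  assume "a \<ge> 3"
  then obtain b where a: "a = b + 3" by (metis le_add_diff_inverse2)
  have "(1::real) \<le> 2 ^ b" by simp
  thus ?thesis by (simp add: a excess_def power_add)
qed

lemma expect_mono_half:
  assumes "F \<subseteq> [{..<n}]\<^bsup>2\<^esup>"
  shows "expect n (mono_half F) = (1 / 2) ^ card F"
  unfolding mono_half_def by (simp add: expect_all_col[OF assms])

lemma expect_mono_half_mult:
  assumes "F \<subseteq> [{..<n}]\<^bsup>2\<^esup>" "G \<subseteq> [{..<n}]\<^bsup>2\<^esup>"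
  shows "expect n (\<lambda>\<omega>. mono_half F \<omega> * mono_half G \<omega>) = (1 / 2) ^ (card F + card G) * (1 + excess (card (F \<inter> G)))"
proof -
  have fin: "finite (F \<inter> G)" using assms by (auto intro: finite_edges)
  have "expect n (\<lambda>\<omega>. mono_half F \<omega> * mono_half G \<omega>) =
      (expect n (\<lambda>\<omega>. all_col F True \<omega> * all_col G True \<omega>) + expect n (\<lambda>\<omega>. all_col F True \<omega> * all_col G False \<omega>)
      + expect n (\<lambda>\<omega>. all_col F False \<omega> * all_col G True \<omega>) + expect n (\<lambda>\<omega>. all_col F False \<omega> * all_col G False \<omega>)) / 4"
    by (simp add: mono_half_def ring_distribs add_divide_distrib)
  also have "\<dots> = (1 / 2) ^ (card F + card G) * (1 + excess (card (F \<inter> G)))"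
  proof (cases "F \<inter> G = {}")
    case True
    thus ?thesis by (simp add: expect_all_col_same expect_all_col_other assms excess_def)
  next
    case False
    hence "card (F \<inter> G) \<noteq> 0" using fin by simp
    then obtain b where "card (F \<inter> G) = Suc b" using not0_implies_Suc by blast
    thus ?thesis using False by (simp add: expect_all_col_same expect_all_col_other assms excess_def)
  qed
  finally show ?thesis .
qed

text \<open>
  The difference is odd under exchanging the colours, so two such variables are uncorrelated
  unless they share an edge.
\<close>
lemma expect_col_diff_mult:
  assumes "F \<subseteq> [{..<n}]\<^bsup>2\<^esup>" "G \<subseteq> [{..<n}]\<^bsup>2\<^esup>"
  shows "expect n (\<lambda>\<omega>. (all_col F True \<omega> - all_col F False \<omega>) * (all_col G True \<omega> - all_col G False \<omega>))
       = (if F \<inter> G = {} then 0 else 2 * (1 / 2) ^ (card F + card G) * 2 ^ card (F \<inter> G))"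
proof -
  have "expect n (\<lambda>\<omega>. (all_col F True \<omega> - all_col F False \<omega>) * (all_col G True \<omega> - all_col G False \<omega>)) =
      expect n (\<lambda>\<omega>. all_col F True \<omega> * all_col G True \<omega>) - expect n (\<lambda>\<omega>. all_col F True \<omega> * all_col G False \<omega>)
      - expect n (\<lambda>\<omega>. all_col F False \<omega> * all_col G True \<omega>) + expect n (\<lambda>\<omega>. all_col F False \<omega> * all_col G False \<omega>)"
    by (simp add: ring_distribs)
  thus ?thesis by (simp add: expect_all_col_same expect_all_col_other assms)
qed

definition covar :: "nat \<Rightarrow> ((nat set \<Rightarrow> bool) \<Rightarrow> real) \<Rightarrow> ((nat set \<Rightarrow> bool) \<Rightarrow> real) \<Rightarrow> real" where
  "covar n f g = expect n (\<lambda>\<omega>. f \<omega> * g \<omega>) - expect n f * expect n g"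

lemma covar_sum:
  "covar n (\<lambda>\<omega>. \<Sum>i\<in>I. f i \<omega>) (\<lambda>\<omega>. \<Sum>j\<in>J. g j \<omega>) = (\<Sum>i\<in>I. \<Sum>j\<in>J. covar n (f i) (g j))"
  by (simp add: covar_def sum_product sum_subtractf)

lemma covar_diff_left: "covar n (\<lambda>\<omega>. f \<omega> - g \<omega>) h = covar n f h - covar n g h"
  and covar_diff_right: "covar n h (\<lambda>\<omega>. f \<omega> - g \<omega>) = covar n h f - covar n h g"
  and covar_scale_left: "covar n (\<lambda>\<omega>. a * f \<omega>) h = a * covar n f h"
  and covar_scale_right: "covar n h (\<lambda>\<omega>. a * f \<omega>) = a * covar n h f"
  by (simp_all add: covar_def algebra_simps)

lemma covar_self: "expect n (\<lambda>\<omega>. (f \<omega> - expect n f)\<^sup>2) = covar n f f"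
  by (simp add: covar_def power2_eq_square algebra_simps)

lemma covar_mono_half:
  assumes "F \<subseteq> [{..<n}]\<^bsup>2\<^esup>" "G \<subseteq> [{..<n}]\<^bsup>2\<^esup>"
  shows "covar n (mono_half F) (mono_half G) = (1 / 2) ^ (card F + card G) * excess (card (F \<inter> G))"
  using expect_mono_half_mult[OF assms] 
  by (simp add: covar_def expect_mono_half assms power_add algebra_simps)

lemma abs_expect_le_sqrt:
  "expect n (\<lambda>\<omega>. \<bar>f \<omega> :: real\<bar>) \<le> sqrt (expect n (\<lambda>\<omega>. (f \<omega>)\<^sup>2))"
proof (rule real_le_rsqrt)
  have "0 \<le> covar n (\<lambda>\<omega>. \<bar>f \<omega>\<bar>) (\<lambda>\<omega>. \<bar>f \<omega>\<bar>)"
    unfolding covar_self[symmetric] by (rule integral_nonneg_AE) simp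
  thus "(expect n (\<lambda>\<omega>. \<bar>f \<omega>\<bar>))\<^sup>2 \<le> expect n (\<lambda>\<omega>. (f \<omega>)\<^sup>2)"
    by (simp add: covar_def power2_eq_square)
qed

lemma expect_mono:
  assumes "\<And>\<omega>. f \<omega> \<le> (g \<omega> :: real)"
  shows "expect n f \<le> expect n g"
  by (rule integral_mono) (use assms in auto)

lemma mono_half_nonneg: "mono_half F \<omega> \<ge> 0"
  using all_col_nonneg[of F True \<omega>] all_col_nonneg[of F False \<omega>] by (simp add: mono_half_def)

lemma mono_half_le_1: "mono_half F \<omega> \<le> 1"
  using all_col_le_1[of F True \<omega>] all_col_le_1[of F False \<omega>] by (simp add: mono_half_def)

section \<open>Counting vertex sets by their overlap\<close>

text \<open>
  Such a set is determined by the part of it outside \<open>B\<close>.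
\<close>
lemma card_nsets_inter:
  assumes V: "finite V" and B: "B \<in> [V]\<^bsup>k\<^esup>" and R: "R \<subseteq> B"
  shows "card {A \<in> [V]\<^bsup>k\<^esup>. A \<inter> B = R} = (card V - k) choose (k - card R)"
proof -
  have B': "B \<subseteq> V" "finite B" "card B = k" using B by (auto simp: nsets_def)
  have finR: "finite R" using R B' finite_subset by blast
  have "bij_betw (\<lambda>A. A \<union> R) ([V - B]\<^bsup>(k - card R)\<^esup>) {A \<in> [V]\<^bsup>k\<^esup>. A \<inter> B = R}"
  proof (rule bij_betwI[where g = "\<lambda>A. A - R"])
    show "(\<lambda>A. A \<union> R) \<in> [V - B]\<^bsup>(k - card R)\<^esup> \<rightarrow> {A \<in> [V]\<^bsup>k\<^esup>. A \<inter> B = R}"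
    proof
      fix A assume A: "A \<in> [V - B]\<^bsup>(k - card R)\<^esup>"
      have "card (A \<union> R) = card A + card R"
        using A R finR by (intro card_Un_disjoint) (auto simp: nsets_def)
      moreover have "card R \<le> k" using R B' by (metis card_mono)
      ultimately show "A \<union> R \<in> {A \<in> [V]\<^bsup>k\<^esup>. A \<inter> B = R}"
        using A R B' finR by (auto simp: nsets_def)
    qed
    show "(\<lambda>A. A - R) \<in> {A \<in> [V]\<^bsup>k\<^esup>. A \<inter> B = R} \<rightarrow> [V - B]\<^bsup>(k - card R)\<^esup>"
      using finR by (auto simp: nsets_def card_Diff_subset)
    show "A \<union> R - R = A" if "A \<in> [V - B]\<^bsup>(k - card R)\<^esup>" for A
      using that R by (auto simp: nsets_def)
    show "A - R \<union> R = A" if "A \<in> {A \<in> [V]\<^bsup>k\<^esup>. A \<inter> B = R}" for A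
      using that by auto
  qed
  from bij_betw_same_card[OF this]
  have "card {A \<in> [V]\<^bsup>k\<^esup>. A \<inter> B = R} = card ([V - B]\<^bsup>(k - card R)\<^esup>)"
    by (rule sym)
  also have "\<dots> = (card V - k) choose (k - card R)"
    using B' by (simp add: card_nsets card_Diff_subset)
  finally show ?thesis .
qed

lemma sum_nsets_inter:
  fixes f :: "'a set \<Rightarrow> real"
  assumes V: "finite V" and B: "B \<in> [V]\<^bsup>k\<^esup>"
  shows "(\<Sum>A\<in>[V]\<^bsup>k\<^esup>. f (A \<inter> B)) = (\<Sum>R\<in>Pow B. real ((card V - k) choose (k - card R)) * f R)"
proof -
  have finB: "finite B" using B by (simp add: nsets_def)
  have "(\<Sum>A\<in>[V]\<^bsup>k\<^esup>. f (A \<inter> B)) = (\<Sum>R\<in>Pow B. \<Sum>A\<in>{A \<in> [V]\<^bsup>k\<^esup>. A \<inter> B = R}. f (A \<inter> B))"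
    using V finB by (subst sum.group) (auto simp: finite_imp_finite_nsets)
  also have "\<dots> = (\<Sum>R\<in>Pow B. real ((card V - k) choose (k - card R)) * f R)"
    using card_nsets_inter[OF V B] by (intro sum.cong) auto
  finally show ?thesis .
qed

lemma sum_Pow_card:
  fixes f :: "nat \<Rightarrow> real"
  assumes "finite B"
  shows "(\<Sum>R\<in>Pow B. f (card R)) = (\<Sum>r\<le>card B. real (card B choose r) * f r)"
proof -
  have "(\<Sum>R\<in>Pow B. f (card R)) = (\<Sum>r\<le>card B. \<Sum>R\<in>{R \<in> Pow B. card R = r}. f (card R))"
    using assms by (subst sum.group) (auto intro: card_mono)
  also have "\<dots> = (\<Sum>r\<le>card B. real (card B choose r) * f r)"
    using n_subsets[OF assms] by (intro sum.cong) (auto simp: Pow_def)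
  finally show ?thesis .
qed

lemma sum_nsets_card_inter:
  fixes f :: "nat \<Rightarrow> real"
  assumes V: "finite V" and A: "A \<in> [V]\<^bsup>k\<^esup>"
  shows "(\<Sum>B\<in>[V]\<^bsup>k\<^esup>. f (card (A \<inter> B))) = (\<Sum>r\<le>k. real (k choose r) * real ((card V - k) choose (k - r)) * f r)"
proof -
  have A': "finite A" "card A = k" using A by (auto simp: nsets_def)
  have "(\<Sum>B\<in>[V]\<^bsup>k\<^esup>. f (card (A \<inter> B))) = (\<Sum>B\<in>[V]\<^bsup>k\<^esup>. f (card (B \<inter> A)))"
    by (simp add: Int_commute)
  also have "\<dots> = (\<Sum>R\<in>Pow A. real ((card V - k) choose (k - card R)) * f (card R))"
    by (rule sum_nsets_inter[OF V A])
  also have "\<dots> = (\<Sum>r\<le>k. real (k choose r) * (real ((card V - k) choose (k - r)) * f r))"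
    using sum_Pow_card[OF A'(1), of "\<lambda>r. real ((card V - k) choose (k - r)) * f r"] A' by simp
  finally show ?thesis by (simp add: mult.assoc)
qed

lemma nsets_2_Int: "[A]\<^bsup>2\<^esup> \<inter> [B]\<^bsup>2\<^esup> = [A \<inter> B]\<^bsup>2\<^esup>"
  by (auto simp: nsets_def)

section \<open>Mean and variance of the number of monochromatic cliques\<close>

lemma num_mono_cliques_eq_sum:
  assumes "2 \<le> k"
  shows "num_mono_cliques n k \<omega> = (\<Sum>A\<in>[{..<n}]\<^bsup>k\<^esup>. 2 * mono_half ([A]\<^bsup>2\<^esup>) \<omega>)"
proof -
  have fin: "finite ([{..<n}]\<^bsup>k\<^esup>)" by (simp add: finite_imp_finite_nsets)
  have "num_mono_cliques n k \<omega> = (\<Sum>A\<in>[{..<n}]\<^bsup>k\<^esup>. of_bool (\<exists>col. \<forall>e\<in>[A]\<^bsup>2\<^esup>. \<omega> e = col))"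
    unfolding num_mono_cliques_def mono_cliques_def
    by (simp add: of_bool_def sum.inter_filter[OF fin, symmetric])
  also have "\<dots> = (\<Sum>A\<in>[{..<n}]\<^bsup>k\<^esup>. 2 * mono_half ([A]\<^bsup>2\<^esup>) \<omega>)"
  proof (intro sum.cong refl)
    fix A assume "A \<in> [{..<n}]\<^bsup>k\<^esup>"
    hence "card A = k" by (simp add: nsets_def)
    hence "[A]\<^bsup>2\<^esup> \<noteq> {}" using assms by (simp add: nsets_eq_empty_iff)
    then obtain e where "e \<in> [A]\<^bsup>2\<^esup>" by blast
    thus "of_bool (\<exists>col. \<forall>e\<in>[A]\<^bsup>2\<^esup>. \<omega> e = col) = 2 * mono_half ([A]\<^bsup>2\<^esup>) \<omega>"
      by (auto simp: mono_half_def all_col_def ex_bool_eq)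
  qed
  finally show ?thesis .
qed

locale clique_count =
  fixes n k :: nat
  assumes k_ge: "4 \<le> k" and n_ge: "4 * k \<le> n"
begin

abbreviation cliques :: "nat set set" ("\<K>") where
  "\<K> \<equiv> [{..<n}]\<^bsup>k\<^esup>"

abbreviation count :: "(nat set \<Rightarrow> bool) \<Rightarrow> real" ("X") where
  "X \<equiv> num_mono_cliques n k"

text \<open>
  The probability that a given clique is red.
\<close>
definition q :: real where
  "q = (1 / 2) ^ (k choose 2)"

lemma q_pos: "q > 0"
  by (simp add: q_def)

lemma clique_props:
  assumes "A \<in> \<K>"
  shows "A \<subseteq> {..<n}" "finite A" "card A = k" "card ([A]\<^bsup>2\<^esup>) = k choose 2" "[A]\<^bsup>2\<^esup> \<subseteq> [{..<n}]\<^bsup>2\<^esup>"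
  using assms by (auto simp: nsets_def card_nsets[unfolded nsets_def])

lemma finite_cliques: "finite \<K>"
  by (simp add: finite_imp_finite_nsets)

lemma card_cliques: "card \<K> = n choose k"
  by (simp add: card_nsets)

lemma card_inter_le: "A \<in> \<K> \<Longrightarrow> card (A \<inter> B) \<le> k"
  using clique_props[of A] by (metis Int_lower1 card_mono)

lemma card_edges_inter:
  "card ([A]\<^bsup>2\<^esup> \<inter> [B]\<^bsup>2\<^esup>) = card (A \<inter> B) choose 2"
  by (simp add: nsets_2_Int card_nsets)

lemma sum_cliques_weighted:
  assumes "A \<in> \<K>"
  shows "(\<Sum>B\<in>\<K>. g (card (A \<inter> B)) * 2 ^ (card (A \<inter> B) choose 2)) = (\<Sum>r\<le>k. g r * overlap_weight n k r)"
proof -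
  have "(\<Sum>B\<in>\<K>. g (card (A \<inter> B)) * 2 ^ (card (A \<inter> B) choose 2))
     = (\<Sum>r\<le>k. real (k choose r) * real ((n - k) choose (k - r)) * (g r * 2 ^ (r choose 2)))"
    using sum_nsets_card_inter[OF _ assms, of "\<lambda>r. g r * 2 ^ (r choose 2)"] by simp
  thus ?thesis by (simp add: overlap_weight_def mult_ac)
qed

text \<open>
  The common row sum of the covariance matrix of the clique indicators, up to the factor \<open>4 * q\<^sup>2\<close>; see
  \<open>variance_count\<close>.
\<close>
definition cov_sum :: real where
  "cov_sum = (\<Sum>r\<le>k. excess (r choose 2) / 2 ^ (r choose 2) * overlap_weight n k r)"

lemma sum_excess:
  assumes "A \<in> \<K>"
  shows "(\<Sum>B\<in>\<K>. excess (card (A \<inter> B) choose 2)) = cov_sum"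
  using sum_cliques_weighted[OF assms, of "\<lambda>r. excess (r choose 2) / 2 ^ (r choose 2)"]
  by (simp add: cov_sum_def)

lemma overlap_sum_alt: "overlap_sum n k = (\<Sum>r\<le>k. of_bool (3 \<le> r) * overlap_weight n k r)"
proof -
  have "{r \<in> {..k}. 3 \<le> r} = {3..k}" by auto
  thus ?thesis
    by (simp add: overlap_sum_def of_bool_def sum.inter_filter[symmetric] if_distrib[where f = "\<lambda>x. x * _"] cong: if_cong)
qed

lemma excess_choose_2_small:
  assumes "r \<le> 2"
  shows "excess (r choose 2) = 0"
proof -
  have "r = 0 \<or> r = 1 \<or> r = 2" using assms by auto
  thus ?thesis by (auto simp: excess_def)
qed

lemma choose_2_ge_3:
  assumes "3 \<le> (r::nat)"
  shows "3 \<le> r choose 2"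
  using binomial_right_mono[OF assms, of 2] by (simp add: choose_two)

text \<open>
  The relative covariance \<open>excess a\<close> is \<open>2 ^ a / 2 - 1\<close>.  It vanishes for sets with at most two common
  vertices, and for at least three common vertices \<open>a \<ge> 3\<close>, so it is between \<open>3 / 8\<close> and \<open>1 / 2\<close> of \<open>2 ^ a\<close>.
\<close>
lemma cov_sum_bounds: "3 / 8 * overlap_sum n k \<le> cov_sum" "cov_sum \<le> overlap_sum n k / 2"
proof -
  have bnd: "3 / 8 * of_bool (3 \<le> r) \<le> excess (r choose 2) / 2 ^ (r choose 2)
     \<and> excess (r choose 2) / 2 ^ (r choose 2) \<le> of_bool (3 \<le> r) / 2" for r :: nat
  proof (cases "3 \<le> r")
    case True
    from excess_ge[OF choose_2_ge_3[OF True]] excess_le[of "r choose 2"] True show ?thesis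
      by (simp add: field_simps)
  next
    case False
    thus ?thesis by (simp add: excess_choose_2_small)
  qed
  have a: "3 / 8 * of_bool (3 \<le> r) * overlap_weight n k r \<le> excess (r choose 2) / 2 ^ (r choose 2) * overlap_weight n k r"
    for r by (rule mult_right_mono[OF conjunct1[OF bnd] overlap_weight_nonneg])
  have b: "excess (r choose 2) / 2 ^ (r choose 2) * overlap_weight n k r \<le> of_bool (3 \<le> r) / 2 * overlap_weight n k r"
    for r by (rule mult_right_mono[OF conjunct2[OF bnd] overlap_weight_nonneg])
  show "3 / 8 * overlap_sum n k \<le> cov_sum"
    unfolding overlap_sum_alt cov_sum_def sum_distrib_left
    by (rule sum_mono) (use a in \<open>simp add: mult.assoc\<close>)
  show "cov_sum \<le> overlap_sum n k / 2"
    unfolding overlap_sum_alt cov_sum_def sum_divide_distrib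
    by (rule sum_mono) (use b in \<open>simp\<close>)
qed

lemma count_eq: "X = (\<lambda>\<omega>. \<Sum>A\<in>\<K>. 2 * mono_half ([A]\<^bsup>2\<^esup>) \<omega>)"
  using num_mono_cliques_eq_sum[of k n] k_ge by auto

lemma expect_count: "expect n X = 2 * q * real (n choose k)"
proof -
  have "expect n X = (\<Sum>A\<in>\<K>. 2 * expect n (mono_half ([A]\<^bsup>2\<^esup>)))"
    by (simp add: count_eq)
  also have "\<dots> = (\<Sum>A\<in>\<K>. 2 * q)"
    by (intro sum.cong refl) (simp add: expect_mono_half clique_props q_def)
  finally show ?thesis by (simp add: card_cliques)
qed

lemma covar_cliques:
  assumes "A \<in> \<K>" "B \<in> \<K>"
  shows "covar n (mono_half ([A]\<^bsup>2\<^esup>)) (mono_half ([B]\<^bsup>2\<^esup>)) = q\<^sup>2 * excess (card (A \<inter> B) choose 2)"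
  using assms by (simp add: covar_mono_half clique_props card_edges_inter q_def power_add power2_eq_square)

lemma variance_count: "covar n X X = 4 * q\<^sup>2 * real (n choose k) * cov_sum"
proof -
  have "covar n X X = (\<Sum>A\<in>\<K>. \<Sum>B\<in>\<K>. covar n (\<lambda>\<omega>. 2 * mono_half ([A]\<^bsup>2\<^esup>) \<omega>) (\<lambda>\<omega>. 2 * mono_half ([B]\<^bsup>2\<^esup>) \<omega>))"
    unfolding count_eq by (rule covar_sum)
  also have "\<dots> = (\<Sum>A\<in>\<K>. \<Sum>B\<in>\<K>. 4 * q\<^sup>2 * excess (card (A \<inter> B) choose 2))"
    by (intro sum.cong refl) (simp add: covar_scale_left covar_scale_right covar_cliques)
  also have "\<dots> = (\<Sum>A\<in>\<K>. 4 * q\<^sup>2 * cov_sum)"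
    by (intro sum.cong refl) (simp add: sum_excess flip: sum_distrib_left)
  finally show ?thesis by (simp add: card_cliques)
qed

section \<open>Size biasing by recolouring a clique\<close>

lemma size_bias_clique:
  fixes h :: "(nat set \<Rightarrow> bool) \<Rightarrow> 'b::{banach, second_countable_topology}"
  assumes "A \<in> \<K>"
  shows "expect n (\<lambda>\<omega>. (2 * mono_half ([A]\<^bsup>2\<^esup>) \<omega>) *\<^sub>R h \<omega>)
       = q *\<^sub>R (\<Sum>col\<in>UNIV. expect n (\<lambda>\<omega>. h (recolor ([A]\<^bsup>2\<^esup>) col \<omega>)))"
proof -
  have "expect n (\<lambda>\<omega>. (2 * mono_half ([A]\<^bsup>2\<^esup>) \<omega>) *\<^sub>R h \<omega>)
      = (\<Sum>col\<in>UNIV. expect n (\<lambda>\<omega>. all_col ([A]\<^bsup>2\<^esup>) col \<omega> *\<^sub>R h \<omega>))"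
    by (simp add: two_mono_half UNIV_bool scaleR_add_left add.commute)
  also have "\<dots> = (\<Sum>col\<in>UNIV. q *\<^sub>R expect n (\<lambda>\<omega>. h (recolor ([A]\<^bsup>2\<^esup>) col \<omega>)))"
    using clique_props(4,5)[OF assms] by (simp add: expect_all_col_scaleR q_def)
  finally show ?thesis by (simp add: scaleR_sum_right)
qed

definition shift :: "nat set \<Rightarrow> bool \<Rightarrow> (nat set \<Rightarrow> bool) \<Rightarrow> real" where
  "shift A col \<omega> = X (recolor ([A]\<^bsup>2\<^esup>) col \<omega>) - X \<omega>"

text \<open>
  Apply \<open>size_bias_clique\<close> to each summand of \<open>X\<close>, and subtract \<open>E X * E (h X)\<close>, distributed over the same
  index set.
\<close>
lemma size_bias_count:
  fixes h :: "real \<Rightarrow> 'b::{banach, second_countable_topology}"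
  shows "expect n (\<lambda>\<omega>. (X \<omega> - expect n X) *\<^sub>R h (X \<omega>))
       = q *\<^sub>R (\<Sum>A\<in>\<K>. \<Sum>col\<in>UNIV. expect n (\<lambda>\<omega>. h (X \<omega> + shift A col \<omega>) - h (X \<omega>)))"
proof -
  have "expect n (\<lambda>\<omega>. X \<omega> *\<^sub>R h (X \<omega>)) = expect n (\<lambda>\<omega>. \<Sum>A\<in>\<K>. (2 * mono_half ([A]\<^bsup>2\<^esup>) \<omega>) *\<^sub>R h (X \<omega>))"
    by (rule arg_cong[where f = "expect n"]) (subst (1) count_eq, simp only: scaleR_sum_left)
  also have "\<dots> = (\<Sum>A\<in>\<K>. q *\<^sub>R (\<Sum>col\<in>UNIV. expect n (\<lambda>\<omega>. h (X \<omega> + shift A col \<omega>))))"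
    by (simp add: size_bias_clique shift_def)
  finally have 1: "expect n (\<lambda>\<omega>. X \<omega> *\<^sub>R h (X \<omega>)) = q *\<^sub>R (\<Sum>A\<in>\<K>. \<Sum>col\<in>UNIV. expect n (\<lambda>\<omega>. h (X \<omega> + shift A col \<omega>)))"
    by (simp add: scaleR_sum_right)
  have 2: "expect n X *\<^sub>R expect n (\<lambda>\<omega>. h (X \<omega>)) = q *\<^sub>R (\<Sum>A\<in>\<K>. \<Sum>col\<in>(UNIV::bool set). expect n (\<lambda>\<omega>. h (X \<omega>)))"
    by (simp add: expect_count card_cliques sum_constant_scaleR mult_ac)
  have "expect n (\<lambda>\<omega>. (X \<omega> - expect n X) *\<^sub>R h (X \<omega>))
      = expect n (\<lambda>\<omega>. X \<omega> *\<^sub>R h (X \<omega>)) - expect n X *\<^sub>R expect n (\<lambda>\<omega>. h (X \<omega>))"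
    by (simp add: scaleR_diff_left)
  thus ?thesis
    unfolding 1 2 by (simp add: sum_subtractf scaleR_diff_right)
qed

definition drift :: "(nat set \<Rightarrow> bool) \<Rightarrow> real" where
  "drift \<omega> = (\<Sum>A\<in>\<K>. \<Sum>col\<in>UNIV. shift A col \<omega>)"

text \<open>
  The identity \<open>size_bias_count\<close> for the identity function.
\<close>
lemma expect_drift: "q * expect n drift = covar n X X"
proof -
  have "covar n X X = expect n (\<lambda>\<omega>. (X \<omega> - expect n X) *\<^sub>R X \<omega>)"
    by (simp add: covar_def algebra_simps)
  also have "\<dots> = q * expect n drift"
    unfolding size_bias_count[of "\<lambda>x. x"] by (simp add: drift_def[abs_def])
  finally show ?thesis by simp
qed

section \<open>Concentration of the drift\<close>

text \<open>
  If \<open>A\<close> and \<open>B\<close> share an edge, the recoloured \<open>B\<close> is monochromatic exactly when its edges outside \<open>A\<close>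
  have the new colour; the sum over both colours is twice \<open>mono_half\<close> of these edges.  So the total change depends on \<open>A\<close> only through \<open>A \<inter> B\<close>, which makes \<open>drift\<close> a sum
  over pairs \<open>R \<subseteq> B\<close>.
\<close>
lemma recolor_sum:
  assumes A: "A \<in> \<K>" and B: "B \<in> \<K>"
  shows "(\<Sum>col\<in>UNIV. 2 * mono_half ([B]\<^bsup>2\<^esup>) (recolor ([A]\<^bsup>2\<^esup>) col \<omega>) - 2 * mono_half ([B]\<^bsup>2\<^esup>) \<omega>)
       = of_bool (2 \<le> card (A \<inter> B)) * (2 * (mono_half ([B]\<^bsup>2\<^esup> - [A \<inter> B]\<^bsup>2\<^esup>) \<omega> - 2 * mono_half ([B]\<^bsup>2\<^esup>) \<omega>))"
proof -
  have D: "[B]\<^bsup>2\<^esup> - [A]\<^bsup>2\<^esup> = [B]\<^bsup>2\<^esup> - [A \<inter> B]\<^bsup>2\<^esup>" by (auto simp: nsets_def)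
  have E: "[B]\<^bsup>2\<^esup> \<inter> [A]\<^bsup>2\<^esup> = {} \<longleftrightarrow> \<not> 2 \<le> card (A \<inter> B)"
    using clique_props(2)[OF A] by (auto simp: nsets_2_Int Int_commute nsets_eq_empty_iff)
  show ?thesis
  proof (cases "2 \<le> card (A \<inter> B)")
    case True
    thus ?thesis using E
      by (simp add: UNIV_bool mono_half_def all_col_recolor_same all_col_recolor_other D algebra_simps)
  next
    case False
    hence "[A \<inter> B]\<^bsup>2\<^esup> = {}"
      using clique_props(2)[OF A] by (auto simp: nsets_eq_empty_iff)
    with False E D show ?thesis
      by (simp add: UNIV_bool mono_half_def all_col_recolor_same all_col_recolor_other)
  qed
qed

definition drift_term :: "nat set \<times> nat set \<Rightarrow> (nat set \<Rightarrow> bool) \<Rightarrow> real" where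
  "drift_term = (\<lambda>(B, R) \<omega>. (of_bool (2 \<le> card R) * real ((n - k) choose (k - card R)) * 2)
      * (mono_half ([B]\<^bsup>2\<^esup> - [R]\<^bsup>2\<^esup>) \<omega> - 2 * mono_half ([B]\<^bsup>2\<^esup>) \<omega>))"

lemma drift_eq: "drift = (\<lambda>\<omega>. \<Sum>i\<in>Sigma \<K> Pow. drift_term i \<omega>)"
proof
  fix \<omega>
  let ?g = "\<lambda>B R. of_bool (2 \<le> card R) * (2 * (mono_half ([B]\<^bsup>2\<^esup> - [R]\<^bsup>2\<^esup>) \<omega> - 2 * mono_half ([B]\<^bsup>2\<^esup>) \<omega>))"
  have "drift \<omega> = (\<Sum>A\<in>\<K>. \<Sum>col\<in>UNIV. \<Sum>B\<in>\<K>. 2 * mono_half ([B]\<^bsup>2\<^esup>) (recolor ([A]\<^bsup>2\<^esup>) col \<omega>) - 2 * mono_half ([B]\<^bsup>2\<^esup>) \<omega>)"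
    by (simp add: drift_def shift_def count_eq sum_subtractf)
  also have "\<dots> = (\<Sum>A\<in>\<K>. \<Sum>B\<in>\<K>. \<Sum>col\<in>UNIV. 2 * mono_half ([B]\<^bsup>2\<^esup>) (recolor ([A]\<^bsup>2\<^esup>) col \<omega>) - 2 * mono_half ([B]\<^bsup>2\<^esup>) \<omega>)"
    by (intro sum.cong refl sum.swap)
  also have "\<dots> = (\<Sum>A\<in>\<K>. \<Sum>B\<in>\<K>. ?g B (A \<inter> B))"
    by (intro sum.cong refl recolor_sum)
  also have "\<dots> = (\<Sum>B\<in>\<K>. \<Sum>A\<in>\<K>. ?g B (A \<inter> B))"
    by (rule sum.swap)
  also have "\<dots> = (\<Sum>B\<in>\<K>. \<Sum>R\<in>Pow B. real ((n - k) choose (k - card R)) * ?g B R)"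
  proof (rule sum.cong[OF refl])
    fix B assume "B \<in> \<K>"
    from sum_nsets_inter[OF _ this, of "?g B"]
    show "(\<Sum>A\<in>\<K>. ?g B (A \<inter> B)) = (\<Sum>R\<in>Pow B. real ((n - k) choose (k - card R)) * ?g B R)"
      by simp
  qed
  also have "\<dots> = (\<Sum>B\<in>\<K>. \<Sum>R\<in>Pow B. drift_term (B, R) \<omega>)"
    by (intro sum.cong refl) (simp add: drift_term_def)
  also have "\<dots> = (\<Sum>i\<in>Sigma \<K> Pow. drift_term i \<omega>)"
    using finite_cliques by (subst sum.Sigma) (auto dest: clique_props(2))
  finally show "drift \<omega> = (\<Sum>i\<in>Sigma \<K> Pow. drift_term i \<omega>)" .
qed

definition drift_weight :: "nat set \<Rightarrow> real" where
  "drift_weight R = of_bool (2 \<le> card R) * real ((n - k) choose (k - card R)) * 2 ^ (card R choose 2)"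

lemma sum_drift_weight:
  assumes "B \<in> \<K>"
  shows "(\<Sum>R\<in>Pow B. drift_weight R) = overlap_weight n k 2 + overlap_sum n k"
proof -
  have "(\<Sum>R\<in>Pow B. drift_weight R) = (\<Sum>r\<le>k. of_bool (2 \<le> r) * overlap_weight n k r)"
    using sum_Pow_card[OF clique_props(2)[OF assms], of "\<lambda>r. of_bool (2 \<le> r) * real ((n - k) choose (k - r)) * 2 ^ (r choose 2)"]
    by (simp add: drift_weight_def overlap_weight_def clique_props(3)[OF assms] mult_ac)
  also have "\<dots> = (\<Sum>r\<in>{2..k}. overlap_weight n k r)"
    by (intro sum.mono_neutral_cong_right) auto
  also have "{2..k} = insert 2 {3..k}" using k_ge by auto
  finally show ?thesis by (simp add: overlap_sum_def)
qed

text \<open>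
  Removing edges from \<open>B\<close> and \<open>B'\<close> decreases the number of common edges, and \<open>excess\<close> is monotone; so the
  covariance of the remainders is at most that of the full cliques, rescaled by the ratio of the means.
  The mixed covariances enter with a negative sign and are dropped.
\<close>
lemma covar_drift_term:
  assumes B: "B \<in> \<K>" "R \<subseteq> B" and B': "B' \<in> \<K>" "R' \<subseteq> B'"
  shows "covar n (drift_term (B, R)) (drift_term (B', R'))
       \<le> 8 * q\<^sup>2 * excess (card (B \<inter> B') choose 2) * (drift_weight R * drift_weight R')"
proof (cases "2 \<le> card R \<and> 2 \<le> card R'")
  case False
  hence "drift_term (B, R) = (\<lambda>_. 0) \<or> drift_term (B', R') = (\<lambda>_. 0)" "drift_weight R * drift_weight R' = 0"
    by (auto simp: drift_term_def drift_weight_def)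
  thus ?thesis by (auto simp: covar_def)
next
  case True
  define F F' where "F = [B]\<^bsup>2\<^esup> - [R]\<^bsup>2\<^esup>" and "F' = [B']\<^bsup>2\<^esup> - [R']\<^bsup>2\<^esup>"
  define c c' where "c = card R choose 2" and "c' = card R' choose 2"
  have sub: "F \<subseteq> [{..<n}]\<^bsup>2\<^esup>" "F' \<subseteq> [{..<n}]\<^bsup>2\<^esup>"
    using clique_props(5)[OF B(1)] clique_props(5)[OF B'(1)] by (auto simp: F_def F'_def)
  note EB = clique_props(5)[OF B(1)] and EB' = clique_props(5)[OF B'(1)]
  have cardF: "card F + c = k choose 2"
  proof -
    have "card ([B]\<^bsup>2\<^esup>) = card F + card ([R]\<^bsup>2\<^esup>)"
      unfolding F_def using nsets_mono[OF B(2), of 2] finite_edges[OF EB]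
      by (metis card_Diff_subset card_mono finite_subset le_add_diff_inverse2)
    thus ?thesis using clique_props(4)[OF B(1)] by (simp add: c_def card_nsets)
  qed
  have cardF': "card F' + c' = k choose 2"
  proof -
    have "card ([B']\<^bsup>2\<^esup>) = card F' + card ([R']\<^bsup>2\<^esup>)"
      unfolding F'_def using nsets_mono[OF B'(2), of 2] finite_edges[OF EB']
      by (metis card_Diff_subset card_mono finite_subset le_add_diff_inverse2)
    thus ?thesis using clique_props(4)[OF B'(1)] by (simp add: c'_def card_nsets)
  qed
  have "1 \<le> c" "1 \<le> c'"
    using True binomial_right_mono[of 2 "card R" 2] binomial_right_mono[of 2 "card R'" 2] by (auto simp: c_def c'_def)
  hence four: "(4::real) \<le> 2 ^ c * 2 ^ c'"
  proof -
    assume "1 \<le> c" "1 \<le> c'"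
    hence "(2::real) ^ 1 * 2 ^ 1 \<le> 2 ^ c * 2 ^ c'"
      by (intro mult_mono power_increasing) auto
    thus ?thesis by simp
  qed
  let ?x = "excess (card (B \<inter> B') choose 2)"
  have pF: "(1 / 2) ^ card F = q * 2 ^ c"
    by (simp add: q_def power_add power_divide flip: cardF)
  have pF': "(1 / 2) ^ card F' = q * 2 ^ c'"
    by (simp add: q_def power_add power_divide flip: cardF')
  have nn: "covar n (mono_half G) (mono_half G') \<ge> 0"
    if "G \<subseteq> [{..<n}]\<^bsup>2\<^esup>" "G' \<subseteq> [{..<n}]\<^bsup>2\<^esup>" for G G'
    using that by (simp add: covar_mono_half excess_nonneg)
  have FF: "covar n (mono_half F) (mono_half F') \<le> q\<^sup>2 * (2 ^ c * 2 ^ c') * ?x"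
  proof -
    have "card (F \<inter> F') \<le> card ([B]\<^bsup>2\<^esup> \<inter> [B']\<^bsup>2\<^esup>)"
      using finite_edges[OF EB] by (intro card_mono) (auto simp: F_def F'_def)
    hence "excess (card (F \<inter> F')) \<le> ?x"
      by (intro excess_mono) (simp add: card_edges_inter)
    hence "q * 2 ^ c * (q * 2 ^ c') * excess (card (F \<inter> F')) \<le> q * 2 ^ c * (q * 2 ^ c') * ?x"
      using q_pos by (intro mult_left_mono) auto
    thus ?thesis
      by (simp add: covar_mono_half[OF sub] power_add pF pF' power2_eq_square mult_ac)
  qed
  let ?D = "covar n (\<lambda>\<omega>. mono_half F \<omega> - 2 * mono_half ([B]\<^bsup>2\<^esup>) \<omega>) (\<lambda>\<omega>. mono_half F' \<omega> - 2 * mono_half ([B']\<^bsup>2\<^esup>) \<omega>)"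
  have "?D \<le> covar n (mono_half F) (mono_half F') + 4 * covar n (mono_half ([B]\<^bsup>2\<^esup>)) (mono_half ([B']\<^bsup>2\<^esup>))"
    using nn[OF sub(1) EB'] nn[OF EB sub(2)]
    by (simp add: covar_diff_left covar_diff_right covar_scale_left covar_scale_right)
  also have "\<dots> \<le> q\<^sup>2 * (2 ^ c * 2 ^ c') * ?x + 2 ^ c * 2 ^ c' * (q\<^sup>2 * ?x)"
    unfolding covar_cliques[OF B(1) B'(1)] using excess_nonneg[of "card (B \<inter> B') choose 2"]
    by (intro add_mono FF mult_right_mono[OF four] mult_nonneg_nonneg) auto
  finally have D: "?D \<le> 2 * q\<^sup>2 * ?x * (2 ^ c * 2 ^ c')" by (simp add: mult_ac)
  let ?u = "\<lambda>R. real ((n - k) choose (k - card R)) * 2"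
  have "covar n (drift_term (B, R)) (drift_term (B', R')) = ?u R * (?u R' * ?D)"
    using True by (simp add: drift_term_def F_def F'_def covar_scale_left covar_scale_right)
  also have "\<dots> \<le> ?u R * (?u R' * (2 * q\<^sup>2 * ?x * (2 ^ c * 2 ^ c')))"
    by (intro mult_left_mono D) auto
  also have "\<dots> = 8 * q\<^sup>2 * ?x * (drift_weight R * drift_weight R')"
    using True by (simp add: drift_weight_def c_def c'_def)
  finally show ?thesis .
qed

text \<open>
  By \<open>covar_drift_term\<close> the covariances are bounded by products of weights times those of the
  cliques, so the double sum factorizes into \<open>Var X\<close> and the square of the total weight.
\<close>
lemma variance_drift:
  "covar n drift drift \<le> 2 * covar n X X * (overlap_weight n k 2 + overlap_sum n k)\<^sup>2"
proof -
  let ?w = "overlap_weight n k 2 + overlap_sum n k"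
  have Sig: "(\<Sum>i\<in>Sigma \<K> Pow. f i) = (\<Sum>B\<in>\<K>. \<Sum>R\<in>Pow B. f (B, R))" for f :: "nat set \<times> nat set \<Rightarrow> real"
    using finite_cliques by (subst sum.Sigma) (auto dest: clique_props(2))
  have "covar n drift drift = (\<Sum>i\<in>Sigma \<K> Pow. \<Sum>j\<in>Sigma \<K> Pow. covar n (drift_term i) (drift_term j))"
    unfolding drift_eq by (rule covar_sum)
  also have "\<dots> = (\<Sum>B\<in>\<K>. \<Sum>R\<in>Pow B. \<Sum>B'\<in>\<K>. \<Sum>R'\<in>Pow B'. covar n (drift_term (B, R)) (drift_term (B', R')))"
    unfolding Sig ..
  also have "\<dots> \<le> (\<Sum>B\<in>\<K>. \<Sum>R\<in>Pow B. \<Sum>B'\<in>\<K>. \<Sum>R'\<in>Pow B'.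
      8 * q\<^sup>2 * excess (card (B \<inter> B') choose 2) * (drift_weight R * drift_weight R'))"
    by (intro sum_mono covar_drift_term) auto
  also have "\<dots> = (\<Sum>B\<in>\<K>. \<Sum>R\<in>Pow B. \<Sum>B'\<in>\<K>. 8 * q\<^sup>2 * excess (card (B \<inter> B') choose 2) * drift_weight R * ?w)"
    by (intro sum.cong refl) (simp add: sum_drift_weight mult.assoc flip: sum_distrib_left)
  also have "\<dots> = (\<Sum>B\<in>\<K>. \<Sum>R\<in>Pow B. 8 * q\<^sup>2 * ?w * drift_weight R * cov_sum)"
    by (intro sum.cong refl) (simp add: mult_ac flip: sum_excess sum_distrib_left sum_distrib_right)
  also have "\<dots> = (\<Sum>B\<in>\<K>. 8 * q\<^sup>2 * ?w * cov_sum * ?w)"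
    by (intro sum.cong refl) (simp add: mult_ac flip: sum_drift_weight sum_distrib_left sum_distrib_right)
  also have "\<dots> = 2 * covar n X X * ?w\<^sup>2"
    by (simp add: card_cliques variance_count power2_eq_square)
  finally show ?thesis .
qed

section \<open>The error in the Stein identity\<close>

text \<open>
  With \<open>g x = exp (\<i> * \<theta> * (x - E X))\<close> the increment in \<open>size_bias_count\<close> is
  \<open>g X * (exp (\<i> * \<theta> * shift A col) - 1)\<close>.  Its linear part sums to \<open>\<i> * \<theta> * drift * g X\<close>; replacing \<open>drift\<close> by its
  mean \<open>Var X / q\<close> costs at most the standard deviation of \<open>drift\<close>.
\<close>
lemma stein_remainder_bound:
  fixes \<theta> :: real
  defines "e \<equiv> \<lambda>\<omega>. iexp (\<theta> * (X \<omega> - expect n X))"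
  shows "cmod (expect n (\<lambda>\<omega>. (X \<omega> - expect n X) *\<^sub>R e \<omega>) - \<i> * \<theta> * covar n X X * expect n e)
     \<le> \<bar>\<theta>\<bar> * q * sqrt (covar n drift drift)
       + q * (\<Sum>A\<in>\<K>. \<Sum>col\<in>UNIV. expect n (\<lambda>\<omega>. cmod (iexp (\<theta> * shift A col \<omega>) - 1 - \<i> * (\<theta> * shift A col \<omega>))))"
proof -
  define \<rho> where "\<rho> A col \<omega> = iexp (\<theta> * shift A col \<omega>) - 1 - \<i> * (\<theta> * shift A col \<omega>)" for A col \<omega>
  have ne: "cmod (e \<omega>) = 1" for \<omega> by (simp add: e_def)
  have step: "iexp (\<theta> * (X \<omega> + shift A col \<omega> - expect n X)) - e \<omega>
      = e \<omega> * \<rho> A col \<omega> + \<i> * \<theta> * (shift A col \<omega> *\<^sub>R e \<omega>)" for A col \<omega>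
  proof -
    have "iexp (\<theta> * (X \<omega> + shift A col \<omega> - expect n X)) = e \<omega> * iexp (\<theta> * shift A col \<omega>)"
      unfolding e_def exp_add[symmetric] by (simp add: algebra_simps)
    thus ?thesis by (simp add: \<rho>_def scaleR_conv_of_real algebra_simps)
  qed
  have "expect n (\<lambda>\<omega>. (X \<omega> - expect n X) *\<^sub>R e \<omega>)
      = q *\<^sub>R (\<Sum>A\<in>\<K>. \<Sum>col\<in>UNIV. expect n (\<lambda>\<omega>. iexp (\<theta> * (X \<omega> + shift A col \<omega> - expect n X)) - e \<omega>))"
    unfolding e_def by (rule size_bias_count)
  also have "\<dots> = q *\<^sub>R (\<Sum>A\<in>\<K>. \<Sum>col\<in>UNIV. expect n (\<lambda>\<omega>. e \<omega> * \<rho> A col \<omega> + \<i> * \<theta> * (shift A col \<omega> *\<^sub>R e \<omega>)))"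
    unfolding step ..
  also have "\<dots> = q *\<^sub>R (\<Sum>A\<in>\<K>. \<Sum>col\<in>UNIV. expect n (\<lambda>\<omega>. e \<omega> * \<rho> A col \<omega>))
      + \<i> * \<theta> * (q *\<^sub>R expect n (\<lambda>\<omega>. drift \<omega> *\<^sub>R e \<omega>))"
  proof -
    have "expect n (\<lambda>\<omega>. drift \<omega> *\<^sub>R e \<omega>) = (\<Sum>A\<in>\<K>. \<Sum>col\<in>UNIV. expect n (\<lambda>\<omega>. shift A col \<omega> *\<^sub>R e \<omega>))"
      by (simp add: drift_def scaleR_sum_left)
    moreover have "expect n (\<lambda>\<omega>. e \<omega> * \<rho> A col \<omega> + \<i> * \<theta> * (shift A col \<omega> *\<^sub>R e \<omega>))
        = expect n (\<lambda>\<omega>. e \<omega> * \<rho> A col \<omega>) + \<i> * \<theta> * expect n (\<lambda>\<omega>. shift A col \<omega> *\<^sub>R e \<omega>)" for A col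
      by (simp del: mult_scaleR_right)
    ultimately show ?thesis
      by (simp only: sum.distrib scaleR_add_right sum_distrib_left[symmetric] mult_scaleR_right)
  qed
  finally have eq1: "expect n (\<lambda>\<omega>. (X \<omega> - expect n X) *\<^sub>R e \<omega>)
      = q *\<^sub>R (\<Sum>A\<in>\<K>. \<Sum>col\<in>UNIV. expect n (\<lambda>\<omega>. e \<omega> * \<rho> A col \<omega>)) + \<i> * \<theta> * (q *\<^sub>R expect n (\<lambda>\<omega>. drift \<omega> *\<^sub>R e \<omega>))" .
  have eq2: "q *\<^sub>R expect n (\<lambda>\<omega>. drift \<omega> *\<^sub>R e \<omega>) - covar n X X * expect n e
      = q *\<^sub>R expect n (\<lambda>\<omega>. (drift \<omega> - expect n drift) *\<^sub>R e \<omega>)"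
  proof -
    have "expect n (\<lambda>\<omega>. (drift \<omega> - expect n drift) *\<^sub>R e \<omega>)
        = expect n (\<lambda>\<omega>. drift \<omega> *\<^sub>R e \<omega>) - expect n drift *\<^sub>R expect n e"
      by (simp add: scaleR_diff_left)
    moreover have "covar n X X * expect n e = q *\<^sub>R (expect n drift *\<^sub>R expect n e)"
      by (simp add: scaleR_conv_of_real flip: expect_drift)
    ultimately show ?thesis by (simp only: scaleR_diff_right)
  qed
  have "expect n (\<lambda>\<omega>. (X \<omega> - expect n X) *\<^sub>R e \<omega>) - \<i> * \<theta> * covar n X X * expect n e
      = q *\<^sub>R (\<Sum>A\<in>\<K>. \<Sum>col\<in>UNIV. expect n (\<lambda>\<omega>. e \<omega> * \<rho> A col \<omega>))
        + \<i> * \<theta> * (q *\<^sub>R expect n (\<lambda>\<omega>. (drift \<omega> - expect n drift) *\<^sub>R e \<omega>))"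
    unfolding eq1 eq2[symmetric] by (simp only: ring_distribs mult.assoc diff_conv_add_uminus ac_simps) simp
  also have "cmod \<dots> \<le> q * (\<Sum>A\<in>\<K>. \<Sum>col\<in>UNIV. expect n (\<lambda>\<omega>. cmod (\<rho> A col \<omega>)))
        + \<bar>\<theta>\<bar> * q * sqrt (covar n drift drift)"
  proof (rule norm_triangle_le, rule add_mono)
    have "cmod (\<Sum>A\<in>\<K>. \<Sum>col\<in>UNIV. expect n (\<lambda>\<omega>. e \<omega> * \<rho> A col \<omega>))
        \<le> (\<Sum>A\<in>\<K>. \<Sum>col\<in>UNIV. expect n (\<lambda>\<omega>. cmod (\<rho> A col \<omega>)))"
    proof (intro sum_norm_le)
      fix A col
      show "cmod (expect n (\<lambda>\<omega>. e \<omega> * \<rho> A col \<omega>)) \<le> expect n (\<lambda>\<omega>. cmod (\<rho> A col \<omega>))"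
        using integral_norm_bound[of "measure_pmf (random_coloring n)" "\<lambda>\<omega>. e \<omega> * \<rho> A col \<omega>"]
        by (simp add: norm_mult ne)
    qed
    thus "cmod (q *\<^sub>R (\<Sum>A\<in>\<K>. \<Sum>col\<in>UNIV. expect n (\<lambda>\<omega>. e \<omega> * \<rho> A col \<omega>)))
        \<le> q * (\<Sum>A\<in>\<K>. \<Sum>col\<in>UNIV. expect n (\<lambda>\<omega>. cmod (\<rho> A col \<omega>)))"
      using q_pos by simp
    have "cmod (expect n (\<lambda>\<omega>. (drift \<omega> - expect n drift) *\<^sub>R e \<omega>)) \<le> expect n (\<lambda>\<omega>. \<bar>drift \<omega> - expect n drift\<bar>)"
      using integral_norm_bound[of "measure_pmf (random_coloring n)" "\<lambda>\<omega>. (drift \<omega> - expect n drift) *\<^sub>R e \<omega>"]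
      by (simp add: ne)
    also have "\<dots> \<le> sqrt (covar n drift drift)"
      using abs_expect_le_sqrt[of n "\<lambda>\<omega>. drift \<omega> - expect n drift"] by (simp add: covar_self)
    finally show "cmod (\<i> * \<theta> * (q *\<^sub>R expect n (\<lambda>\<omega>. (drift \<omega> - expect n drift) *\<^sub>R e \<omega>))) \<le> \<bar>\<theta>\<bar> * q * sqrt (covar n drift drift)"
      using q_pos by (simp add: norm_mult mult.assoc mult_left_mono)
  qed
  finally show ?thesis by (simp add: \<rho>_def add.commute)
qed

definition shift_at :: "nat set \<Rightarrow> bool \<Rightarrow> nat set \<Rightarrow> (nat set \<Rightarrow> bool) \<Rightarrow> real" where
  "shift_at A col B \<omega> = 2 * mono_half ([B]\<^bsup>2\<^esup>) (recolor ([A]\<^bsup>2\<^esup>) col \<omega>) - 2 * mono_half ([B]\<^bsup>2\<^esup>) \<omega>"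

definition shift_part :: "(nat \<Rightarrow> bool) \<Rightarrow> nat set \<Rightarrow> bool \<Rightarrow> (nat set \<Rightarrow> bool) \<Rightarrow> real" where
  "shift_part P A col \<omega> = (\<Sum>B\<in>\<K>. of_bool (P (card (A \<inter> B))) * shift_at A col B \<omega>)"

lemma edges_inter_empty_iff:
  assumes "A \<in> \<K>"
  shows "[B]\<^bsup>2\<^esup> \<inter> [A]\<^bsup>2\<^esup> = {} \<longleftrightarrow> card (A \<inter> B) < 2"
  using clique_props(2)[OF assms] by (auto simp: nsets_2_Int Int_commute nsets_eq_empty_iff)

lemma shift_at_disjoint:
  assumes "A \<in> \<K>" "card (A \<inter> B) < 2"
  shows "shift_at A col B \<omega> = 0"
proof -
  have "[B]\<^bsup>2\<^esup> \<inter> [A]\<^bsup>2\<^esup> = {}" using assms by (simp add: edges_inter_empty_iff)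
  hence "[B]\<^bsup>2\<^esup> - [A]\<^bsup>2\<^esup> = [B]\<^bsup>2\<^esup>" by auto
  thus ?thesis using \<open>_ = {}\<close>
    by (cases col) (simp_all add: shift_at_def two_mono_half all_col_recolor_same all_col_recolor_other)
qed

text \<open>
  After recolouring \<open>A\<close> the clique \<open>B\<close> can only be monochromatic in the colour \<open>col\<close>.
\<close>
lemma shift_at_meet:
  assumes "A \<in> \<K>" "2 \<le> card (A \<inter> B)"
  shows "shift_at A col B \<omega> = all_col ([B]\<^bsup>2\<^esup> - [A]\<^bsup>2\<^esup>) col \<omega> - all_col ([B]\<^bsup>2\<^esup>) True \<omega> - all_col ([B]\<^bsup>2\<^esup>) False \<omega>"
proof -
  have "[B]\<^bsup>2\<^esup> \<inter> [A]\<^bsup>2\<^esup> \<noteq> {}" using assms by (simp add: edges_inter_empty_iff)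
  thus ?thesis
    by (cases col) (simp_all add: shift_at_def two_mono_half all_col_recolor_same all_col_recolor_other)
qed

text \<open>
  If \<open>B\<close> is monochromatic before or after the recolouring, then so are its edges outside \<open>A\<close>.
\<close>
lemma abs_shift_at_le:
  assumes "A \<in> \<K>"
  shows "\<bar>shift_at A col B \<omega>\<bar> \<le> 2 * mono_half ([B]\<^bsup>2\<^esup> - [A]\<^bsup>2\<^esup>) \<omega>"
proof (cases "card (A \<inter> B) < 2")
  case True
  thus ?thesis using mono_half_nonneg by (simp add: shift_at_disjoint[OF assms])
next
  case False
  let ?F = "[B]\<^bsup>2\<^esup> - [A]\<^bsup>2\<^esup>"
  have "all_col ([B]\<^bsup>2\<^esup>) c \<omega> \<le> all_col ?F c \<omega>" for c
    by (rule all_col_antimono) auto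
  from this[of True] this[of False] False show ?thesis
    using all_col_nonneg[of "[B]\<^bsup>2\<^esup>" True \<omega>] all_col_nonneg[of "[B]\<^bsup>2\<^esup>" False \<omega>]
      all_col_nonneg[of ?F True \<omega>] all_col_nonneg[of ?F False \<omega>]
    by (cases col) (simp_all add: shift_at_meet[OF assms] two_mono_half)
qed

lemma edges_diff:
  assumes "A \<in> \<K>" "B \<in> \<K>"
  shows "[B]\<^bsup>2\<^esup> - [A]\<^bsup>2\<^esup> \<subseteq> [{..<n}]\<^bsup>2\<^esup>" "(1 / 2 :: real) ^ card ([B]\<^bsup>2\<^esup> - [A]\<^bsup>2\<^esup>) = q * 2 ^ (card (A \<inter> B) choose 2)"
proof -
  note B = clique_props(4,5)[OF assms(2)]
  show "[B]\<^bsup>2\<^esup> - [A]\<^bsup>2\<^esup> \<subseteq> [{..<n}]\<^bsup>2\<^esup>" using B by auto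
  have "card ([B]\<^bsup>2\<^esup>) = card ([B]\<^bsup>2\<^esup> - [A]\<^bsup>2\<^esup>) + card ([B]\<^bsup>2\<^esup> \<inter> [A]\<^bsup>2\<^esup>)"
    using finite_edges[OF B(2)] by (metis card_Int_Diff add.commute)
  hence "k choose 2 = card ([B]\<^bsup>2\<^esup> - [A]\<^bsup>2\<^esup>) + (card (A \<inter> B) choose 2)"
    by (simp add: clique_props(3)[OF assms(2)] card_nsets card_edges_inter Int_commute)
  thus "(1 / 2 :: real) ^ card ([B]\<^bsup>2\<^esup> - [A]\<^bsup>2\<^esup>) = q * 2 ^ (card (A \<inter> B) choose 2)"
    by (simp add: q_def power_add power_divide)
qed

lemma shift_split:
  assumes "A \<in> \<K>"
  shows "shift A col \<omega> = shift_part ((=) 2) A col \<omega> + shift_part ((=) 3) A col \<omega>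
     + shift_part ((=) k) A col \<omega> + shift_part (\<lambda>r. 4 \<le> r \<and> r < k) A col \<omega>"
proof -
  have "shift A col \<omega> = (\<Sum>B\<in>\<K>. shift_at A col B \<omega>)"
    by (simp add: shift_def count_eq shift_at_def sum_subtractf)
  also have "\<dots> = (\<Sum>B\<in>\<K>. (of_bool (2 = card (A \<inter> B)) + of_bool (3 = card (A \<inter> B)) + of_bool (k = card (A \<inter> B))
      + of_bool (4 \<le> card (A \<inter> B) \<and> card (A \<inter> B) < k)) * shift_at A col B \<omega>)"
  proof (rule sum.cong[OF refl])
    fix B
    consider "card (A \<inter> B) < 2" | "card (A \<inter> B) = 2" | "card (A \<inter> B) = 3" | "card (A \<inter> B) = k"
      | "4 \<le> card (A \<inter> B)" "card (A \<inter> B) < k"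
      using card_inter_le[OF assms, of B] by linarith
    thus "shift_at A col B \<omega> = (of_bool (2 = card (A \<inter> B)) + of_bool (3 = card (A \<inter> B)) + of_bool (k = card (A \<inter> B))
      + of_bool (4 \<le> card (A \<inter> B) \<and> card (A \<inter> B) < k)) * shift_at A col B \<omega>"
      using k_ge by cases (auto simp: shift_at_disjoint[OF assms])
  qed
  finally show ?thesis by (simp add: shift_part_def ring_distribs sum.distrib)
qed

lemma shift_part_top:
  assumes "A \<in> \<K>"
  shows "\<bar>shift_part ((=) k) A col \<omega>\<bar> \<le> 2"
proof -
  have eq: "k = card (A \<inter> B) \<longleftrightarrow> B = A" if "B \<in> \<K>" for B
  proof
    assume c: "k = card (A \<inter> B)"
    have "A \<inter> B = A"
      using clique_props(2,3)[OF assms] c by (intro card_subset_eq) simp_all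
    moreover have "A \<inter> B = B"
      using clique_props(2,3)[OF that] c by (intro card_subset_eq) simp_all
    ultimately show "B = A" by simp
  qed (use clique_props(3)[OF assms] in simp)
  have "shift_part ((=) k) A col \<omega> = (\<Sum>B\<in>\<K>. if B = A then shift_at A col A \<omega> else 0)"
    unfolding shift_part_def by (rule sum.cong) (auto simp: eq)
  also have "\<dots> = shift_at A col A \<omega>"
    using assms finite_cliques by simp
  finally show ?thesis
    using abs_shift_at_le[OF assms, of col A \<omega>] mono_half_le_1[of "[A]\<^bsup>2\<^esup> - [A]\<^bsup>2\<^esup>" \<omega>] by simp
qed

lemma expect_abs_shift_part_mid:
  assumes "A \<in> \<K>"
  shows "expect n (\<lambda>\<omega>. \<bar>shift_part (\<lambda>r. 4 \<le> r \<and> r < k) A col \<omega>\<bar>) \<le> 2 * q * overlap_mid n k"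
proof -
  let ?P = "\<lambda>r. 4 \<le> r \<and> r < k"
  have "expect n (\<lambda>\<omega>. \<bar>shift_part ?P A col \<omega>\<bar>)
      \<le> expect n (\<lambda>\<omega>. \<Sum>B\<in>\<K>. of_bool (?P (card (A \<inter> B))) * (2 * mono_half ([B]\<^bsup>2\<^esup> - [A]\<^bsup>2\<^esup>) \<omega>))"
  proof (rule expect_mono)
    fix \<omega>
    have "\<bar>shift_part ?P A col \<omega>\<bar> \<le> (\<Sum>B\<in>\<K>. \<bar>of_bool (?P (card (A \<inter> B))) * shift_at A col B \<omega>\<bar>)"
      unfolding shift_part_def by (rule sum_abs)
    also have "\<dots> \<le> (\<Sum>B\<in>\<K>. of_bool (?P (card (A \<inter> B))) * (2 * mono_half ([B]\<^bsup>2\<^esup> - [A]\<^bsup>2\<^esup>) \<omega>))"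
      unfolding abs_mult by (intro sum_mono mult_mono abs_shift_at_le[OF assms]) auto
    finally show "\<bar>shift_part ?P A col \<omega>\<bar> \<le> (\<Sum>B\<in>\<K>. of_bool (?P (card (A \<inter> B))) * (2 * mono_half ([B]\<^bsup>2\<^esup> - [A]\<^bsup>2\<^esup>) \<omega>))" .
  qed
  also have "\<dots> = (\<Sum>B\<in>\<K>. of_bool (?P (card (A \<inter> B))) * (2 * expect n (mono_half ([B]\<^bsup>2\<^esup> - [A]\<^bsup>2\<^esup>))))"
    by simp
  also have "\<dots> = (\<Sum>B\<in>\<K>. 2 * q * of_bool (?P (card (A \<inter> B))) * 2 ^ (card (A \<inter> B) choose 2))"
    by (rule sum.cong[OF refl]) (simp add: expect_mono_half edges_diff[OF assms])
  also have "\<dots> = (\<Sum>r\<le>k. 2 * q * of_bool (?P r) * overlap_weight n k r)"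
    by (rule sum_cliques_weighted[OF assms])
  also have "\<dots> = (\<Sum>r\<in>{4..<k}. 2 * q * overlap_weight n k r)"
    by (rule sum.mono_neutral_cong_right) auto
  finally show ?thesis by (simp add: overlap_mid_def sum_distrib_left)
qed

lemma sum_of_bool_card:
  assumes "A \<in> \<K>" "m \<le> k"
  shows "(\<Sum>B\<in>\<K>. of_bool (m = card (A \<inter> B))) = overlap_weight n k m / 2 ^ (m choose 2)"
proof -
  have "(\<Sum>B\<in>\<K>. of_bool (m = card (A \<inter> B)) / 2 ^ (card (A \<inter> B) choose 2) * 2 ^ (card (A \<inter> B) choose 2))
      = (\<Sum>r\<le>k. of_bool (m = r) / 2 ^ (r choose 2) * overlap_weight n k r)"
    by (rule sum_cliques_weighted[OF assms(1)])
  also have "\<dots> = (\<Sum>r\<le>k. if m = r then overlap_weight n k m / 2 ^ (m choose 2) else 0)"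
    by (rule sum.cong) auto
  finally show ?thesis using assms(2) by simp
qed

text \<open>
  The second moment is a sum over \<open>B\<close> and \<open>B'\<close> that both meet \<open>A\<close> in three vertices.  For the
  correlation of \<open>B\<close> and \<open>B'\<close> the restriction on \<open>B'\<close> can be dropped: removing the three edges inside \<open>A\<close>
  from a clique costs only the factor \<open>2 ^ 3\<close>, and what remains is the row sum \<open>cov_sum\<close>.
\<close>
lemma expect_shift_part_3:
  assumes "A \<in> \<K>"
  shows "expect n (\<lambda>\<omega>. (shift_part ((=) 3) A col \<omega>)\<^sup>2) \<le> 20 * q\<^sup>2 * (overlap_sum n k)\<^sup>2"
proof -
  let ?T = "overlap_sum n k"
  define b :: "nat set \<Rightarrow> real" where "b B = of_bool (3 = card (A \<inter> B))" for B
  define F where "F B = [B]\<^bsup>2\<^esup> - [A]\<^bsup>2\<^esup>" for B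
  define N where "N = (\<Sum>B\<in>\<K>. b B)"
  have b: "b B \<ge> 0" for B by (simp add: b_def)
  have T: "?T \<ge> 0" using overlap_sum_pos[OF k_ge] by (rule less_imp_le)
  have N: "0 \<le> N" "N \<le> ?T / 8"
  proof -
    show "0 \<le> N" unfolding N_def by (intro sum_nonneg b)
    have "(3::nat) choose 2 = 3" by (simp add: choose_two)
    hence "N = overlap_weight n k 3 / 8"
      using sum_of_bool_card[OF assms, of 3] k_ge by (simp add: N_def b_def)
    also have "\<dots> \<le> ?T / 8"
      using overlap_sum_split[OF k_ge, of n] overlap_mid_nonneg[of n k] overlap_weight_nonneg[of n k k] by simp
    finally show "N \<le> ?T / 8" .
  qed
  have "expect n (\<lambda>\<omega>. (shift_part ((=) 3) A col \<omega>)\<^sup>2)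
      \<le> expect n (\<lambda>\<omega>. (\<Sum>B\<in>\<K>. b B * (2 * mono_half (F B) \<omega>))\<^sup>2)"
  proof (rule expect_mono)
    fix \<omega>
    have "\<bar>shift_part ((=) 3) A col \<omega>\<bar> \<le> (\<Sum>B\<in>\<K>. \<bar>b B * shift_at A col B \<omega>\<bar>)"
      unfolding shift_part_def b_def by (rule sum_abs)
    also have "\<dots> \<le> (\<Sum>B\<in>\<K>. b B * (2 * mono_half (F B) \<omega>))"
      unfolding abs_mult F_def by (intro sum_mono mult_mono abs_shift_at_le[OF assms]) (auto simp: b_def)
    finally show "(shift_part ((=) 3) A col \<omega>)\<^sup>2 \<le> (\<Sum>B\<in>\<K>. b B * (2 * mono_half (F B) \<omega>))\<^sup>2"
      by (metis abs_ge_zero power2_abs power_mono)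
  qed
  also have "\<dots> = (\<Sum>B\<in>\<K>. \<Sum>B'\<in>\<K>. b B * b B' * 4 * expect n (\<lambda>\<omega>. mono_half (F B) \<omega> * mono_half (F B') \<omega>))"
    by (simp add: power2_eq_square sum_product mult_ac)
  also have "\<dots> \<le> (\<Sum>B\<in>\<K>. \<Sum>B'\<in>\<K>. 256 * q\<^sup>2 * (b B * b B' + b B * excess (card (B \<inter> B') choose 2)))"
  proof (intro sum_mono)
    fix B B' assume B: "B \<in> \<K>" "B' \<in> \<K>"
    show "b B * b B' * 4 * expect n (\<lambda>\<omega>. mono_half (F B) \<omega> * mono_half (F B') \<omega>)
        \<le> 256 * q\<^sup>2 * (b B * b B' + b B * excess (card (B \<inter> B') choose 2))"
    proof (cases "3 = card (A \<inter> B) \<and> 3 = card (A \<inter> B')")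
      case False
      hence z: "b B * b B' = 0" by (auto simp: b_def)
      have "0 \<le> 256 * q\<^sup>2 * (b B * b B' + b B * excess (card (B \<inter> B') choose 2))"
        using b excess_nonneg by (intro mult_nonneg_nonneg add_nonneg_nonneg) auto
      thus ?thesis unfolding z by simp
    next
      case True
      have sub: "F B \<subseteq> [{..<n}]\<^bsup>2\<^esup>" "F B' \<subseteq> [{..<n}]\<^bsup>2\<^esup>"
        using edges_diff(1)[OF assms] B by (auto simp: F_def)
      have "card (A \<inter> B) = 3" "card (A \<inter> B') = 3" "(3::nat) choose 2 = 3"
        using True by (simp_all add: choose_two)
      hence p: "(1 / 2) ^ card (F B) = q * 8" "(1 / 2) ^ card (F B') = q * 8"
        unfolding F_def using B by (simp_all add: edges_diff(2)[OF assms])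
      have "card (F B \<inter> F B') \<le> card ([B]\<^bsup>2\<^esup> \<inter> [B']\<^bsup>2\<^esup>)"
        using finite_edges[OF clique_props(5)[OF B(1)]] by (intro card_mono) (auto simp: F_def)
      hence "excess (card (F B \<inter> F B')) \<le> excess (card (B \<inter> B') choose 2)"
        by (intro excess_mono) (simp add: card_edges_inter)
      hence "q * 8 * (q * 8) * (1 + excess (card (F B \<inter> F B'))) \<le> q * 8 * (q * 8) * (1 + excess (card (B \<inter> B') choose 2))"
        using q_pos by (intro mult_left_mono add_left_mono) auto
      thus ?thesis
        using True by (simp add: b_def expect_mono_half_mult[OF sub] power_add p power2_eq_square)
    qed
  qed
  also have "\<dots> = 256 * q\<^sup>2 * (N * N + N * cov_sum)"
  proof -
    have 1: "(\<Sum>B\<in>\<K>. \<Sum>B'\<in>\<K>. b B * b B') = N * N" by (simp add: N_def sum_product)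
    have 2: "(\<Sum>B\<in>\<K>. \<Sum>B'\<in>\<K>. b B * excess (card (B \<inter> B') choose 2)) = N * cov_sum"
      by (simp add: N_def sum_excess sum_distrib_right flip: sum_distrib_left)
    have "(\<Sum>B\<in>\<K>. \<Sum>B'\<in>\<K>. 256 * q\<^sup>2 * (b B * b B' + b B * excess (card (B \<inter> B') choose 2)))
        = 256 * q\<^sup>2 * ((\<Sum>B\<in>\<K>. \<Sum>B'\<in>\<K>. b B * b B') + (\<Sum>B\<in>\<K>. \<Sum>B'\<in>\<K>. b B * excess (card (B \<inter> B') choose 2)))"
      by (simp only: sum.distrib distrib_left sum_distrib_left)
    thus ?thesis unfolding 1 2 .
  qed
  also have "\<dots> \<le> 256 * q\<^sup>2 * (?T / 8 * (?T / 8) + ?T / 8 * (?T / 2))"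
    using N T cov_sum_bounds by (intro mult_left_mono add_mono mult_mono) auto
  also have "\<dots> = 20 * q\<^sup>2 * ?T\<^sup>2" by (simp add: power2_eq_square)
  finally show ?thesis .
qed

text \<open>
  Let \<open>e\<close> be the edge common to \<open>A\<close> and \<open>B\<close>, and \<open>F\<close> the set of the other edges of \<open>B\<close>.  The recolouring
  changes \<open>B\<close> only if \<open>e\<close> changes its colour, and then the change is, up to a sign depending on \<open>e\<close> alone,
  the odd variable \<open>all_col F True - all_col F False\<close>.  For two cliques through \<open>e\<close> these are uncorrelated
  unless the cliques share a third vertex, hence \<open>overlap_sum\<close> in the bound.
\<close>
lemma expect_shift_part_2:
  assumes A: "A \<in> \<K>"
  shows "expect n (\<lambda>\<omega>. (shift_part ((=) 2) A col \<omega>)\<^sup>2)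
       \<le> (real k)\<^sup>2 * q\<^sup>2 * overlap_sum n k * overlap_weight n k 2"
proof -
  let ?T = "overlap_sum n k" and ?E = "[A]\<^bsup>2\<^esup>"
  define D where "D B \<omega> = all_col ([B]\<^bsup>2\<^esup> - ?E) True \<omega> - all_col ([B]\<^bsup>2\<^esup> - ?E) False \<omega>" for B \<omega>
  define b :: "nat set \<Rightarrow> nat set \<Rightarrow> real" where "b e B = of_bool (A \<inter> B = e)" for e B
  define Y where "Y e \<omega> = (\<Sum>B\<in>\<K>. b e B * D B \<omega>)" for e \<omega>
  \<comment> \<open>The sign of the change depends on \<open>e\<close> but not on \<open>B\<close>, so cancellation within \<open>Y e\<close> is preserved.\<close>
  define s :: "nat set \<Rightarrow> (nat set \<Rightarrow> bool) \<Rightarrow> real" where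
    "s e \<omega> = of_bool (\<omega> e \<noteq> col) * (if col then 1 else - 1)" for e \<omega>
  have finE: "finite ?E" using clique_props(5)[OF A] by (rule finite_edges)
  have T: "?T \<ge> 0" using overlap_sum_pos[OF k_ge] by (rule less_imp_le)
  have split: "of_bool (2 = card (A \<inter> B)) = (\<Sum>e\<in>?E. b e B)" for B
  proof -
    have "(\<Sum>e\<in>?E. b e B) = (\<Sum>e\<in>?E. if e = A \<inter> B then 1 else 0)"
      by (rule sum.cong) (auto simp: b_def)
    also have "\<dots> = of_bool (A \<inter> B \<in> ?E)" using finE by simp
    also have "A \<inter> B \<in> ?E \<longleftrightarrow> 2 = card (A \<inter> B)"
      using clique_props(2)[OF A] by (auto simp: nsets_def)
    finally show ?thesis by simp
  qed
  have flip: "b e B * shift_at A col B \<omega> = s e \<omega> * (b e B * D B \<omega>)" if e: "e \<in> ?E" for e B \<omega>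
  proof (cases "A \<inter> B = e")
    case True
    let ?F = "[B]\<^bsup>2\<^esup> - ?E"
    have "x = e" if "x \<in> [e]\<^bsup>2\<^esup>" for x
      using that e card_subset_eq[of e x] by (simp add: nsets_def)
    hence "[A \<inter> B]\<^bsup>2\<^esup> = {e}"
      using e unfolding True by (auto simp: nsets_def)
    hence ins: "[B]\<^bsup>2\<^esup> = insert e ?F" using nsets_2_Int[of A B] by blast
    have c: "2 \<le> card (A \<inter> B)" using e True by (simp add: nsets_def)
    have "all_col ([B]\<^bsup>2\<^esup>) c \<omega> = of_bool (\<omega> e = c) * all_col ?F c \<omega>" for c
      by (subst ins) (simp add: all_col_def)
    thus ?thesis using True
      by (cases col; cases "\<omega> e") (simp_all add: shift_at_meet[OF A c] b_def s_def D_def)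
  qed (simp add: b_def)
  have part: "shift_part ((=) 2) A col \<omega> = (\<Sum>e\<in>?E. s e \<omega> * Y e \<omega>)" for \<omega>
  proof -
    have "shift_part ((=) 2) A col \<omega> = (\<Sum>B\<in>\<K>. \<Sum>e\<in>?E. b e B * shift_at A col B \<omega>)"
      by (simp only: shift_part_def split sum_distrib_right)
    also have "\<dots> = (\<Sum>e\<in>?E. \<Sum>B\<in>\<K>. b e B * shift_at A col B \<omega>)" by (rule sum.swap)
    also have "\<dots> = (\<Sum>e\<in>?E. s e \<omega> * Y e \<omega>)"
      by (simp add: flip Y_def sum_distrib_left)
    finally show ?thesis .
  qed
  have EY: "expect n (\<lambda>\<omega>. (Y e \<omega>)\<^sup>2) \<le> (\<Sum>B\<in>\<K>. b e B) * (4 * q\<^sup>2 * ?T)" if e: "e \<in> ?E" for e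
  proof -
    have sq: "(Y e \<omega>)\<^sup>2 = (\<Sum>B\<in>\<K>. \<Sum>B'\<in>\<K>. b e B * b e B' * (D B \<omega> * D B' \<omega>))" for \<omega>
      by (simp add: Y_def power2_eq_square sum_product mult_ac)
    have "expect n (\<lambda>\<omega>. (Y e \<omega>)\<^sup>2) = (\<Sum>B\<in>\<K>. \<Sum>B'\<in>\<K>. b e B * b e B' * expect n (\<lambda>\<omega>. D B \<omega> * D B' \<omega>))"
      unfolding sq by simp
    also have "\<dots> \<le> (\<Sum>B\<in>\<K>. \<Sum>B'\<in>\<K>. b e B * (4 * q\<^sup>2 * of_bool (3 \<le> card (B \<inter> B')) * 2 ^ (card (B \<inter> B') choose 2)))"
    proof (intro sum_mono)
      fix B B' assume B: "B \<in> \<K>" "B' \<in> \<K>"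
      let ?F = "[B]\<^bsup>2\<^esup> - ?E" and ?F' = "[B']\<^bsup>2\<^esup> - ?E"
      let ?s = "card (B \<inter> B')"
      let ?r = "b e B * (4 * q\<^sup>2 * of_bool (3 \<le> ?s) * 2 ^ (?s choose 2))"
      have sub: "?F \<subseteq> [{..<n}]\<^bsup>2\<^esup>" "?F' \<subseteq> [{..<n}]\<^bsup>2\<^esup>"
        using edges_diff(1)[OF A] B by auto
      have r: "?r \<ge> 0" by (simp add: b_def)
      show "b e B * b e B' * expect n (\<lambda>\<omega>. D B \<omega> * D B' \<omega>) \<le> ?r"
      proof (cases "A \<inter> B = e \<and> A \<inter> B' = e \<and> ?F \<inter> ?F' \<noteq> {}")
        case False
        hence z: "b e B * b e B' * expect n (\<lambda>\<omega>. D B \<omega> * D B' \<omega>) = 0"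
          using expect_col_diff_mult[OF sub] by (auto simp: b_def D_def)
        show ?thesis unfolding z by (rule r)
      next
        case True
        have two: "card (A \<inter> B) = 2" "card (A \<inter> B') = 2" using e True by (auto simp: nsets_def)
        have "(2::nat) choose 2 = 1" by simp
        hence p: "(1 / 2) ^ card ?F = q * 2" "(1 / 2) ^ card ?F' = q * 2"
          using B by (simp_all add: edges_diff(2)[OF A] two)
        have eBB: "e \<in> [B \<inter> B']\<^bsup>2\<^esup>"
          using e True by (auto simp: nsets_def)
        have finBB: "finite ([B \<inter> B']\<^bsup>2\<^esup>)"
          using clique_props(2)[OF B(1)] by (simp add: finite_imp_finite_nsets)
        have "?F \<inter> ?F' \<subseteq> [B \<inter> B']\<^bsup>2\<^esup> - {e}"
          using e by (auto simp flip: nsets_2_Int)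
        hence "card (?F \<inter> ?F') \<le> card ([B \<inter> B']\<^bsup>2\<^esup> - {e})"
          using finBB by (intro card_mono) auto
        hence le: "Suc (card (?F \<inter> ?F')) \<le> ?s choose 2"
          using eBB finBB card_Suc_Diff1[OF finBB eBB] by (simp add: card_nsets)
        have "card (?F \<inter> ?F') \<noteq> 0"
          using True finite_edges[OF sub(1)] by simp
        hence "2 \<le> ?s choose 2" using le by linarith
        hence s3: "3 \<le> ?s"
          using binomial_right_mono[of ?s 2 2] by (cases "?s \<le> 2") auto
        have "(2::real) * 2 ^ card (?F \<inter> ?F') \<le> 2 ^ (?s choose 2)"
          using power_increasing[OF le, of "2::real"] by simp
        hence "(q * 2) * (q * 2) * (2 * 2 ^ card (?F \<inter> ?F')) \<le> (q * 2) * (q * 2) * 2 ^ (?s choose 2)"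
          using q_pos by (intro mult_left_mono) auto
        moreover have "expect n (\<lambda>\<omega>. D B \<omega> * D B' \<omega>) = (q * 2) * (q * 2) * (2 * 2 ^ card (?F \<inter> ?F'))"
          unfolding D_def expect_col_diff_mult[OF sub] using True by (simp add: power_add p)
        ultimately show ?thesis
          using True s3 by (simp add: b_def power2_eq_square)
      qed
    qed
    also have "\<dots> = (\<Sum>B\<in>\<K>. b e B * (\<Sum>B'\<in>\<K>. 4 * q\<^sup>2 * of_bool (3 \<le> card (B \<inter> B')) * 2 ^ (card (B \<inter> B') choose 2)))"
      by (simp only: sum_distrib_left)
    also have "\<dots> = (\<Sum>B\<in>\<K>. b e B * (4 * q\<^sup>2 * ?T))"
    proof (rule sum.cong[OF refl])
      fix B assume B: "B \<in> \<K>"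
      have "(\<Sum>B'\<in>\<K>. 4 * q\<^sup>2 * of_bool (3 \<le> card (B \<inter> B')) * 2 ^ (card (B \<inter> B') choose 2)) = 4 * q\<^sup>2 * ?T"
        using sum_cliques_weighted[OF B, of "\<lambda>r. 4 * q\<^sup>2 * of_bool (3 \<le> r)"]
        unfolding overlap_sum_alt sum_distrib_left by (simp only: mult.assoc)
      thus "b e B * (\<Sum>B'\<in>\<K>. 4 * q\<^sup>2 * of_bool (3 \<le> card (B \<inter> B')) * 2 ^ (card (B \<inter> B') choose 2)) = b e B * (4 * q\<^sup>2 * ?T)"
        by simp
    qed
    finally show ?thesis by (simp add: sum_distrib_right)
  qed
  have "expect n (\<lambda>\<omega>. (shift_part ((=) 2) A col \<omega>)\<^sup>2) \<le> expect n (\<lambda>\<omega>. real (card ?E) * (\<Sum>e\<in>?E. (Y e \<omega>)\<^sup>2))"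
  proof (rule expect_mono)
    fix \<omega>
    have "(shift_part ((=) 2) A col \<omega>)\<^sup>2 \<le> (\<Sum>e\<in>?E. (s e \<omega> * Y e \<omega>)\<^sup>2) * real (card ?E)"
      unfolding part by (rule sum_squared_le_sum_of_squares)
    also have "\<dots> \<le> (\<Sum>e\<in>?E. (Y e \<omega>)\<^sup>2) * real (card ?E)"
      by (intro mult_right_mono sum_mono) (auto simp: s_def power_mult_distrib)
    finally show "(shift_part ((=) 2) A col \<omega>)\<^sup>2 \<le> real (card ?E) * (\<Sum>e\<in>?E. (Y e \<omega>)\<^sup>2)" by (simp add: mult.commute)
  qed
  also have "\<dots> = real (card ?E) * (\<Sum>e\<in>?E. expect n (\<lambda>\<omega>. (Y e \<omega>)\<^sup>2))"
    by simp
  also have "\<dots> \<le> real (card ?E) * (\<Sum>e\<in>?E. (\<Sum>B\<in>\<K>. b e B) * (4 * q\<^sup>2 * ?T))"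
    by (intro mult_left_mono sum_mono EY) auto
  also have "\<dots> = real (k choose 2) * (overlap_weight n k 2 / 2 * (4 * q\<^sup>2 * ?T))"
  proof -
    have "(\<Sum>e\<in>?E. \<Sum>B\<in>\<K>. b e B) = (\<Sum>B\<in>\<K>. of_bool (2 = card (A \<inter> B)))"
      unfolding split by (rule sum.swap)
    also have "\<dots> = overlap_weight n k 2 / 2"
      using sum_of_bool_card[OF A, of 2] k_ge by simp
    finally show ?thesis by (simp only: clique_props(4)[OF A] sum_distrib_right[symmetric])
  qed
  also have "\<dots> = (2 * real (k choose 2)) * (q\<^sup>2 * ?T * overlap_weight n k 2)"
    by simp
  also have "\<dots> \<le> (real k)\<^sup>2 * (q\<^sup>2 * ?T * overlap_weight n k 2)"
  proof (intro mult_right_mono)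
    have "2 * (k choose 2) \<le> k * k" by (simp add: two_times_choose_two)
    hence "real (2 * (k choose 2)) \<le> real (k * k)" by (simp only: of_nat_le_iff)
    thus "2 * real (k choose 2) \<le> (real k)\<^sup>2" by (simp add: power2_eq_square)
  qed (use T overlap_weight_nonneg in simp)
  finally show ?thesis by (simp add: mult.assoc)
qed

text \<open>
  The parts for \<open>r = 2\<close>, \<open>r = 3\<close> and \<open>r = k\<close> enter quadratically, the middle part linearly.
\<close>
lemma expect_iexp_shift_remainder:
  fixes \<theta> :: real
  assumes A: "A \<in> \<K>"
  shows "expect n (\<lambda>\<omega>. cmod (iexp (\<theta> * shift A col \<omega>) - 1 - \<i> * (\<theta> * shift A col \<omega>)))
     \<le> 3 / 2 * \<theta>\<^sup>2 * ((real k)\<^sup>2 * q\<^sup>2 * overlap_sum n k * overlap_weight n k 2 + 20 * q\<^sup>2 * (overlap_sum n k)\<^sup>2 + 4)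
       + 4 * \<bar>\<theta>\<bar> * q * overlap_mid n k"
proof -
  define u v w m where "u = shift_part ((=) 2) A col" and "v = shift_part ((=) 3) A col"
    and "w = shift_part ((=) k) A col" and "m = shift_part (\<lambda>r. 4 \<le> r \<and> r < k) A col"
  have "expect n (\<lambda>\<omega>. cmod (iexp (\<theta> * shift A col \<omega>) - 1 - \<i> * (\<theta> * shift A col \<omega>)))
      \<le> expect n (\<lambda>\<omega>. 3 / 2 * \<theta>\<^sup>2 * ((u \<omega>)\<^sup>2 + (v \<omega>)\<^sup>2 + 4) + 2 * \<bar>\<theta>\<bar> * \<bar>m \<omega>\<bar>)"
  proof (rule expect_mono)
    fix \<omega>
    have s: "\<theta> * shift A col \<omega> = \<theta> * (u \<omega> + v \<omega> + w \<omega>) + \<theta> * m \<omega>"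
      unfolding shift_split[OF A] by (simp add: u_def v_def w_def m_def algebra_simps)
    have "(w \<omega>)\<^sup>2 \<le> 2\<^sup>2"
      using shift_part_top[OF A, of col \<omega>] by (intro power2_le_iff_abs_le[THEN iffD2]) (auto simp: w_def)
    moreover have "(u \<omega> + v \<omega> + w \<omega>)\<^sup>2 \<le> 3 * ((u \<omega>)\<^sup>2 + (v \<omega>)\<^sup>2 + (w \<omega>)\<^sup>2)"
    proof -
      have "0 \<le> (u \<omega> - v \<omega>)\<^sup>2 + (u \<omega> - w \<omega>)\<^sup>2 + (v \<omega> - w \<omega>)\<^sup>2" by simp
      thus ?thesis by (simp add: power2_eq_square algebra_simps)
    qed
    ultimately have "(u \<omega> + v \<omega> + w \<omega>)\<^sup>2 \<le> 3 * ((u \<omega>)\<^sup>2 + (v \<omega>)\<^sup>2 + 4)" by simp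
    hence "\<theta>\<^sup>2 * (u \<omega> + v \<omega> + w \<omega>)\<^sup>2 \<le> \<theta>\<^sup>2 * (3 * ((u \<omega>)\<^sup>2 + (v \<omega>)\<^sup>2 + 4))"
      by (intro mult_left_mono) auto
    hence "(\<theta> * (u \<omega> + v \<omega> + w \<omega>))\<^sup>2 / 2 \<le> 3 / 2 * \<theta>\<^sup>2 * ((u \<omega>)\<^sup>2 + (v \<omega>)\<^sup>2 + 4)"
      by (subst power_mult_distrib) linarith
    moreover have "cmod (iexp (\<theta> * shift A col \<omega>) - 1 - \<i> * (\<theta> * shift A col \<omega>))
        \<le> (\<theta> * (u \<omega> + v \<omega> + w \<omega>))\<^sup>2 / 2 + 2 * \<bar>\<theta> * m \<omega>\<bar>"
      using iexp_remainder_add[of "\<theta> * (u \<omega> + v \<omega> + w \<omega>)" "\<theta> * m \<omega>"] unfolding s by simp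
    ultimately show "cmod (iexp (\<theta> * shift A col \<omega>) - 1 - \<i> * (\<theta> * shift A col \<omega>))
        \<le> 3 / 2 * \<theta>\<^sup>2 * ((u \<omega>)\<^sup>2 + (v \<omega>)\<^sup>2 + 4) + 2 * \<bar>\<theta>\<bar> * \<bar>m \<omega>\<bar>"
      by (simp add: abs_mult)
  qed
  also have "\<dots> = 3 / 2 * \<theta>\<^sup>2 * (expect n (\<lambda>\<omega>. (u \<omega>)\<^sup>2) + expect n (\<lambda>\<omega>. (v \<omega>)\<^sup>2) + 4) + 2 * \<bar>\<theta>\<bar> * expect n (\<lambda>\<omega>. \<bar>m \<omega>\<bar>)"
    by simp
  also have "\<dots> \<le> 3 / 2 * \<theta>\<^sup>2 * ((real k)\<^sup>2 * q\<^sup>2 * overlap_sum n k * overlap_weight n k 2 + 20 * q\<^sup>2 * (overlap_sum n k)\<^sup>2 + 4)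
       + 2 * \<bar>\<theta>\<bar> * (2 * q * overlap_mid n k)"
    unfolding u_def v_def m_def
    by (intro add_mono mult_left_mono expect_shift_part_2[OF A] expect_shift_part_3[OF A] expect_abs_shift_part_mid[OF A]) auto
  finally show ?thesis by simp
qed

text \<open>
  Here \<open>S\<close> is the square root of \<open>(n choose k) * T\<close>.  The standard deviation of \<open>X\<close> is at least \<open>q * S\<close>, and
  inserting this lower bound into the previous estimates with \<open>\<theta> = t / \<sigma>\<close> eliminates \<open>q\<close>.  The constant
  \<open>4\<close> from the clique \<open>A\<close> itself is absorbed by means of \<open>1 \<le> q * T\<close>, which holds as \<open>w k = 1 / q\<close>.
\<close>
lemma stein_standardized:
  defines "W \<equiv> standardized (random_coloring n) X"
  shows "clt_error n k \<ge> 0"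
    and "cmod (expect n (\<lambda>\<omega>. complex_of_real (W \<omega>) * iexp (t * W \<omega>)) - \<i> * t * expect n (\<lambda>\<omega>. iexp (t * W \<omega>)))
       \<le> clt_error n k * (\<bar>t\<bar> + t\<^sup>2)"
proof -
  define T w2 Tm C S where "T = overlap_sum n k" and "w2 = overlap_weight n k 2" and "Tm = overlap_mid n k"
    and "C = real (n choose k)" and "S = sqrt (C * T)"
  define \<sigma> where "\<sigma> = sqrt (covar n X X)"
  have T: "T > 0" unfolding T_def by (rule overlap_sum_pos[OF k_ge])
  have C: "C > 0" using n_ge by (simp add: C_def)
  have S: "S > 0" "S\<^sup>2 = C * T" using T C by (simp_all add: S_def)
  have nn: "w2 \<ge> 0" "Tm \<ge> 0" by (simp_all add: w2_def Tm_def overlap_weight_nonneg overlap_mid_nonneg)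
  have err: "clt_error n k = 80 * (T / S + (real k)\<^sup>2 * w2 / S + Tm / T)"
  proof -
    have "sqrt (T / C) = T / S"
      using T C by (simp add: S_def real_sqrt_divide real_sqrt_mult field_simps)
    moreover have "sqrt (real k ^ 4 * w2\<^sup>2 / (C * T)) = sqrt (((real k)\<^sup>2 * w2)\<^sup>2) / S"
      by (simp add: S_def real_sqrt_divide power_mult_distrib)
    hence "sqrt (real k ^ 4 * w2\<^sup>2 / (C * T)) = (real k)\<^sup>2 * w2 / S"
      using nn by (simp only: real_sqrt_abs) simp
    ultimately show ?thesis by (simp add: clt_error_def T_def w2_def Tm_def C_def)
  qed
  show "clt_error n k \<ge> 0"
    unfolding err using T S nn by (intro mult_nonneg_nonneg add_nonneg_nonneg divide_nonneg_pos) auto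
  have q0: "q > 0" by (rule q_pos)
  have qT: "1 \<le> q * T"
  proof -
    have "overlap_weight n k k \<le> T"
      using overlap_sum_split[OF k_ge, of n] overlap_mid_nonneg[of n k] overlap_weight_nonneg[of n k 3] by (simp add: T_def)
    hence "q * overlap_weight n k k \<le> q * T" using q0 by (intro mult_left_mono) auto
    thus ?thesis by (simp add: overlap_weight_self q_def flip: power_mult_distrib)
  qed
  have var: "covar n X X \<ge> (q * S)\<^sup>2"
  proof -
    have "T \<le> 4 * cov_sum" using cov_sum_bounds(1) T by (simp add: T_def)
    hence "q\<^sup>2 * C * T \<le> q\<^sup>2 * C * (4 * cov_sum)" using C by (intro mult_left_mono) auto
    thus ?thesis by (simp add: variance_count power_mult_distrib S(2) C_def mult_ac)
  qed
  have \<sigma>: "q * S \<le> \<sigma>" "\<sigma> > 0" "\<sigma>\<^sup>2 = covar n X X"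
  proof -
    have "covar n X X \<ge> 0" using var by (rule order.trans[rotated]) simp
    thus "\<sigma>\<^sup>2 = covar n X X" by (simp add: \<sigma>_def)
    show "q * S \<le> \<sigma>" unfolding \<sigma>_def by (rule real_le_rsqrt[OF var])
    thus "\<sigma> > 0" using q0 S(1) by (meson less_le_trans mult_pos_pos)
  qed
  have W: "W = (\<lambda>\<omega>. (X \<omega> - expect n X) / \<sigma>)"
    by (simp add: W_def standardized_def[abs_def] \<sigma>_def covar_self)
  define \<theta> where "\<theta> = t / \<sigma>"
  define e where "e = (\<lambda>\<omega>. iexp (\<theta> * (X \<omega> - expect n X)))"
  have e: "iexp (t * W \<omega>) = e \<omega>" for \<omega> by (simp add: W \<theta>_def e_def)
  have "expect n (\<lambda>\<omega>. complex_of_real (W \<omega>) * iexp (t * W \<omega>)) - \<i> * t * expect n (\<lambda>\<omega>. iexp (t * W \<omega>))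
      = (1 / \<sigma>) *\<^sub>R (expect n (\<lambda>\<omega>. (X \<omega> - expect n X) *\<^sub>R e \<omega>) - \<i> * \<theta> * covar n X X * expect n e)"
  proof -
    have "complex_of_real (W \<omega>) * e \<omega> = (1 / \<sigma>) *\<^sub>R ((X \<omega> - expect n X) *\<^sub>R e \<omega>)" for \<omega>
      by (simp add: W scaleR_conv_of_real)
    hence "expect n (\<lambda>\<omega>. complex_of_real (W \<omega>) * e \<omega>) = (1 / \<sigma>) *\<^sub>R expect n (\<lambda>\<omega>. (X \<omega> - expect n X) *\<^sub>R e \<omega>)"
      by (simp only: integral_scaleR_right)
    moreover have "\<i> * t * expect n e = (1 / \<sigma>) *\<^sub>R (\<i> * \<theta> * covar n X X * expect n e)"
      using \<sigma>(2) by (simp add: \<theta>_def scaleR_conv_of_real power2_eq_square flip: \<sigma>(3))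
    ultimately show ?thesis by (simp only: e scaleR_diff_right)
  qed
  hence "cmod (expect n (\<lambda>\<omega>. complex_of_real (W \<omega>) * iexp (t * W \<omega>)) - \<i> * t * expect n (\<lambda>\<omega>. iexp (t * W \<omega>)))
      = (1 / \<sigma>) * cmod (expect n (\<lambda>\<omega>. (X \<omega> - expect n X) *\<^sub>R e \<omega>) - \<i> * \<theta> * covar n X X * expect n e)"
    using \<sigma>(2) by simp
  also have "\<dots> \<le> (1 / \<sigma>) * (\<bar>\<theta>\<bar> * q * sqrt (covar n drift drift)
       + q * (\<Sum>A\<in>\<K>. \<Sum>col\<in>UNIV. expect n (\<lambda>\<omega>. cmod (iexp (\<theta> * shift A col \<omega>) - 1 - \<i> * (\<theta> * shift A col \<omega>)))))"
    using \<sigma>(2) unfolding e_def by (intro mult_left_mono stein_remainder_bound) auto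
  also have "\<dots> \<le> (1 / \<sigma>) * (\<bar>\<theta>\<bar> * q * (2 * \<sigma> * (w2 + T))
       + q * (\<Sum>A\<in>\<K>. \<Sum>col\<in>(UNIV :: bool set). 3 / 2 * \<theta>\<^sup>2 * ((real k)\<^sup>2 * q\<^sup>2 * T * w2 + 20 * q\<^sup>2 * T\<^sup>2 + 4) + 4 * \<bar>\<theta>\<bar> * q * Tm))"
  proof (intro mult_left_mono add_mono)
    have "covar n drift drift \<le> 2 * \<sigma>\<^sup>2 * (w2 + T)\<^sup>2"
      using variance_drift by (simp add: \<sigma>(3) w2_def T_def)
    also have "\<dots> \<le> (2 * \<sigma> * (w2 + T))\<^sup>2" by (simp add: power_mult_distrib)
    finally show "sqrt (covar n drift drift) \<le> 2 * \<sigma> * (w2 + T)"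
      using \<sigma>(2) nn T by (intro real_le_lsqrt) auto
    show "(\<Sum>A\<in>\<K>. \<Sum>col\<in>UNIV. expect n (\<lambda>\<omega>. cmod (iexp (\<theta> * shift A col \<omega>) - 1 - \<i> * (\<theta> * shift A col \<omega>))))
        \<le> (\<Sum>A\<in>\<K>. \<Sum>col\<in>(UNIV :: bool set). 3 / 2 * \<theta>\<^sup>2 * ((real k)\<^sup>2 * q\<^sup>2 * T * w2 + 20 * q\<^sup>2 * T\<^sup>2 + 4) + 4 * \<bar>\<theta>\<bar> * q * Tm)"
      unfolding T_def w2_def Tm_def by (intro sum_mono expect_iexp_shift_remainder)
  qed (use q0 \<sigma>(2) in auto)
  also have "\<dots> = (1 / \<sigma>) * (\<bar>\<theta>\<bar> * q * (2 * \<sigma> * (w2 + T))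
       + q * (2 * C * (3 / 2 * \<theta>\<^sup>2 * ((real k)\<^sup>2 * q\<^sup>2 * T * w2 + 20 * q\<^sup>2 * T\<^sup>2 + 4) + 4 * \<bar>\<theta>\<bar> * q * Tm)))"
    by (simp add: card_cliques C_def)
  also have "\<dots> = \<bar>t\<bar> * (2 * (w2 + T)) * (q / \<sigma>)
       + 3 * t\<^sup>2 * (C * ((real k)\<^sup>2 * T * w2 + 20 * T\<^sup>2 + 4 / q\<^sup>2)) * (q / \<sigma>) ^ 3 + \<bar>t\<bar> * (8 * C * Tm) * (q / \<sigma>)\<^sup>2"
    using \<sigma>(2) q0 by (simp add: \<theta>_def field_simps power2_eq_square power3_eq_cube)
  also have "\<dots> \<le> \<bar>t\<bar> * (2 * (w2 + T)) * (1 / S)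
       + 3 * t\<^sup>2 * (C * ((real k)\<^sup>2 * T * w2 + 20 * T\<^sup>2 + 4 * T\<^sup>2)) * (1 / S) ^ 3 + \<bar>t\<bar> * (8 * C * Tm) * (1 / S)\<^sup>2"
  proof -
    have r: "q / \<sigma> \<le> 1 / S" "0 \<le> q / \<sigma>" using \<sigma> S(1) q0 by (simp_all add: field_simps)
    have "1 / q \<le> T" using qT q0 by (simp add: field_simps)
    hence "(1 / q)\<^sup>2 \<le> T\<^sup>2" using q0 by (intro power_mono) auto
    hence q2: "4 / q\<^sup>2 \<le> 4 * T\<^sup>2" by (simp add: power_divide)
    show ?thesis
      using T C nn q0 r S(1) q2
      by (intro add_mono mult_mono power_mono order_refl mult_nonneg_nonneg add_nonneg_nonneg) auto
  qed
  also have "\<dots> = \<bar>t\<bar> * (2 * (w2 / S + T / S) + 8 * (Tm / T)) + t\<^sup>2 * (3 * ((real k)\<^sup>2 * w2 / S) + 72 * (T / S))"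
  proof -
    have C_eq: "C = S\<^sup>2 / T" using S(2) T by simp
    show ?thesis unfolding C_eq using S(1) T by (simp add: field_simps power2_eq_square power3_eq_cube)
  qed
  also have "\<dots> \<le> \<bar>t\<bar> * clt_error n k + t\<^sup>2 * clt_error n k"
  proof (intro add_mono mult_left_mono)
    have "1 \<le> (real k)\<^sup>2" using k_ge by (intro one_le_power) auto
    hence "1 * w2 \<le> (real k)\<^sup>2 * w2" using nn by (intro mult_right_mono) auto
    hence a: "w2 / S \<le> (real k)\<^sup>2 * w2 / S" using S(1) by (intro divide_right_mono) auto
    have b: "0 \<le> w2 / S" "0 \<le> T / S" "0 \<le> Tm / T" using nn T S(1) by auto
    have "2 * (x + y) + 8 * z \<le> 80 * (y + v + z)" "3 * v + 72 * y \<le> 80 * (y + v + z)"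
      if "x \<le> v" "0 \<le> x" "0 \<le> y" "0 \<le> z" for x y z v :: real
      using that by (simp_all add: algebra_simps)
    from this[OF a b]
    show "2 * (w2 / S + T / S) + 8 * (Tm / T) \<le> clt_error n k"
      "3 * ((real k)\<^sup>2 * w2 / S) + 72 * (T / S) \<le> clt_error n k"
      unfolding err .
  qed auto
  finally show "cmod (expect n (\<lambda>\<omega>. complex_of_real (W \<omega>) * iexp (t * W \<omega>)) - \<i> * t * expect n (\<lambda>\<omega>. iexp (t * W \<omega>)))
       \<le> clt_error n k * (\<bar>t\<bar> + t\<^sup>2)" by (simp add: algebra_simps)
qed

end

section \<open>Asymptotic normality\<close>

theorem corollary3:
  fixes n :: "nat \<Rightarrow> nat" and \<epsilon> :: "nat \<Rightarrow> real"
  assumes "\<And>k. k \<ge> 1 \<Longrightarrow> n k > 0"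
    and "\<epsilon> \<longlonglongrightarrow> 0"
    and "\<forall>\<^sub>F k in sequentially.
           real (n k) \<ge> sqrt 2 * real k / exp 1 * 2 powr (real k / 2) * (1 + \<epsilon> k)"
  shows "weak_conv_m
           (\<lambda>k. distr (measure_pmf (random_coloring (n k))) borel
                  (standardized (random_coloring (n k)) (num_mono_cliques (n k) k)))
           std_normal_distribution"
proof (rule levy_continuity)
  show "real_distribution (distr (measure_pmf (random_coloring (n k))) borel
                  (standardized (random_coloring (n k)) (num_mono_cliques (n k) k)))" for k
    by (rule prob_space.real_distribution_distr) (simp_all add: prob_space_measure_pmf)
  show "real_distribution std_normal_distribution"
    by (rule real_dist_normal_dist)
  fix t :: real
  let ?char = "\<lambda>k. char (distr (measure_pmf (random_coloring (n k))) borel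
                  (standardized (random_coloring (n k)) (num_mono_cliques (n k) k))) t"
  have bound: "\<forall>\<^sub>F k in sequentially. norm (?char k - exp (- (t\<^sup>2) / 2)) \<le> clt_error (n k) k * (t\<^sup>2 + \<bar>t\<bar> ^ 3)"
    using overlap_asymptotics(1)[OF assms(2,3)]
  proof eventually_elim
    case (elim k)
    then interpret clique_count "n k" k by unfold_locales auto
    show ?case
      by (rule stein_char_bound[OF finite_random_coloring stein_standardized])
  qed
  have "(\<lambda>k. clt_error (n k) k * (t\<^sup>2 + \<bar>t\<bar> ^ 3)) \<longlonglongrightarrow> 0"
    by (rule tendsto_mult_left_zero[OF clt_error_tendsto_0[OF assms(2,3)]])
  hence "(\<lambda>k. ?char k - exp (- (t\<^sup>2) / 2)) \<longlonglongrightarrow> 0"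
    by (rule Lim_null_comparison[OF bound])
  thus "?char \<longlonglongrightarrow> char std_normal_distribution t"
    by (simp add: char_std_normal_distribution LIM_zero_iff)
qed

end
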